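(* For $2\le t\le 5$, $R^4(BK_t,BK_t)=t+2$, and for every integer $t\ge 6$, $R^4(BK_t,BK_t)=t+1$.
   Context: For a graph $G=(V,E)$ and an integer $r\ge 2$, $BG$ (the set of Berge copies of $G$) is the set of $r$-uniform hypergraphs $\mathcal{H}'$ for which there exist an injection $\phi: V\to V(\mathcal{H}')$ and a bijection $\psi: E\to E(\mathcal{H}')$ such that $\{\phi(u),\phi(v)\}\subseteq \psi(uv)$ for every edge $uv\in E$. $K_n$ denotes the complete graph on $n$ vertices. For collections $\mathcal{F}_1,\mathcal{F}_2$ of $r$-uniform hypergraphs, $R^r(\mathcal{F}_1,\mathcal{F}_2)$ is the least $N$ such that every 2-coloring of the hyperedges of the complete $r$-uniform hypergraph on $N$ vertices contains a subhypergraph of the first color isomorphic to a member of $\mathcal{F}_1$ or one of the second color isomorphic to a member of $\mathcal{F}_2$. Here $r=4$. *)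

theory Defs
  imports Main "HOL-Library.Extended_Nat"
begin

record 'a hypergraph =
  verts :: "'a set"
  edges :: "'a set set"

definition uniform_hypergraph :: "nat \<Rightarrow> 'a hypergraph \<Rightarrow> bool" where
  "uniform_hypergraph r H \<longleftrightarrow>
     finite (verts H) \<and> (\<forall>e\<in>edges H. e \<subseteq> verts H \<and> card e = r)"

definition complete_hypergraph :: "nat \<Rightarrow> nat \<Rightarrow> nat hypergraph" where
  "complete_hypergraph r n = \<lparr>verts = {..<n}, edges = {e. e \<subseteq> {..<n} \<and> card e = r}\<rparr>"

text \<open>A simple graph is a 2-uniform hypergraph: the edge \<open>uv\<close> is the set \<open>{u, v}\<close>.\<close>

abbreviation complete_graph :: "nat \<Rightarrow> nat hypergraph" where
  "complete_graph n \<equiv> complete_hypergraph 2 n"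

definition berge :: "nat \<Rightarrow> 'a hypergraph \<Rightarrow> 'b hypergraph set" where
  "berge r G = {H. uniform_hypergraph r H \<and>
     (\<exists>\<phi> \<psi>. inj_on \<phi> (verts G) \<and> \<phi> ` verts G \<subseteq> verts H \<and>
            bij_betw \<psi> (edges G) (edges H) \<and>
            (\<forall>u v. {u, v} \<in> edges G \<longrightarrow> {\<phi> u, \<phi> v} \<subseteq> \<psi> {u, v}))}"

definition subhypergraph :: "'a hypergraph \<Rightarrow> 'a hypergraph \<Rightarrow> bool" where
  "subhypergraph H' H \<longleftrightarrow>
     verts H' \<subseteq> verts H \<and> edges H' \<subseteq> edges H \<and> (\<forall>e\<in>edges H'. e \<subseteq> verts H')"

definition hypergraph_iso :: "'a hypergraph \<Rightarrow> 'b hypergraph \<Rightarrow> bool" where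
  "hypergraph_iso H H' \<longleftrightarrow>
     (\<exists>f. bij_betw f (verts H) (verts H') \<and> edges H' = (\<lambda>e. f ` e) ` edges H)"

text \<open>A 2-coloring is a function to \<^typ>\<open>bool\<close>, of which only the values on the hyperedges of the
  complete hypergraph matter; \<^const>\<open>True\<close> is the first color and \<^const>\<open>False\<close> the second.\<close>

definition has_colored_copy ::
  "nat \<Rightarrow> nat \<Rightarrow> (nat set \<Rightarrow> bool) \<Rightarrow> bool \<Rightarrow> 'a hypergraph set \<Rightarrow> bool" where
  "has_colored_copy r N c b \<F> \<longleftrightarrow>
     (\<exists>H'. subhypergraph H' (complete_hypergraph r N) \<and> (\<forall>e\<in>edges H'. c e = b) \<and>
           (\<exists>H\<in>\<F>. hypergraph_iso H' H))"

text \<open>The infimum in \<^typ>\<open>enat\<close> is the least element of a nonempty set and \<^term>\<open>\<infinity>\<close> for the empty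
  set, so a finite value includes the claim that some \<open>N\<close> has the Ramsey property.\<close>

definition ramsey_number :: "nat \<Rightarrow> 'a hypergraph set \<Rightarrow> 'b hypergraph set \<Rightarrow> enat" where
  "ramsey_number r \<F>\<^sub>1 \<F>\<^sub>2 =
     Inf {enat N | N. \<forall>c. has_colored_copy r N c True \<F>\<^sub>1 \<or> has_colored_copy r N c False \<F>\<^sub>2}"

text \<open>Members of a Berge family are finite, so vertices in \<^typ>\<open>nat\<close> cover all of them up to
  isomorphism.\<close>

abbreviation BK :: "nat \<Rightarrow> nat \<Rightarrow> nat hypergraph set" where
  "BK r t \<equiv> berge r (complete_graph t)"

end

theory Submission
  imports Defs
begin

text \<open>
  Fix a set of core vertices. By Hall's theorem the hyperedges of one color contain a Berge clique on
  this core unless there is a set \<open>S\<close> of core pairs such that fewer than \<open>|S|\<close> hyperedges of that color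
  contain a member of \<open>S\<close>.

  For \<open>t = 6\<close> and seven vertices, take the majority color, with at least 18 of the 35 quadruples. At
  least \<open>17 + |S|\<close> quadruples contain a member of \<open>S\<close> as soon as \<open>S\<close> is not a star, so every obstruction
  is a star. Obstructions exist for all cores, hence for cores that avoid the center of a given star,
  and two or three such stars together already force 18 quadruples of the other color.

  For the step from \<open>t\<close> to \<open>t + 1\<close>, delete a vertex \<open>v\<close> and take a monochromatic Berge clique on the
  remaining vertices. If it does not extend to \<open>v\<close>, Hall's theorem yields a star centered at \<open>v\<close> that is
  deficient in this color. A deficient star of one color and one of the other color at different centers
  share too many quadruples, unless one of them is a single pair and the other one nearly full; in that
  exceptional case the second color consists only of quadruples containing that pair, and the first
  color wins. If all deficient stars have the same color, then every pair lies in so many quadruples of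
  the other color that this color wins.

  For the lower bounds, color a quadruple by whether it contains a fixed pair.
\<close>

section \<open>Hall's theorem and Berge cliques\<close>

theorem hall_marriage:
  assumes "finite I" "\<And>i. i \<in> I \<Longrightarrow> finite (A i)"
    and "\<And>J. J \<subseteq> I \<Longrightarrow> card J \<le> card (\<Union>(A ` J))"
  shows "\<exists>f. inj_on f I \<and> (\<forall>i\<in>I. f i \<in> A i)"
  using assms
proof (induction "card I" arbitrary: I A rule: less_induct)
  case less
  note fin = less.prems(1) and finA = less.prems(2) and hall = less.prems(3)
  consider "I = {}"
    | "I \<noteq> {}" "\<And>J. J \<subset> I \<Longrightarrow> J \<noteq> {} \<Longrightarrow> card J < card (\<Union>(A ` J))"
    | J where "J \<subset> I" "J \<noteq> {}" "card (\<Union>(A ` J)) = card J"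
    using hall by (metis le_eq_less_or_eq psubset_imp_subset)
  then show ?case
  proof cases
    case 1
    then show ?thesis by simp
  next
    case 2
    then obtain i where i: "i \<in> I" by blast
    have "A i \<noteq> {}" using hall[of "{i}"] i by auto
    then obtain x where x: "x \<in> A i" by blast
    have "\<exists>f. inj_on f (I - {i}) \<and> (\<forall>j\<in>I - {i}. f j \<in> A j - {x})"
    proof (rule less.hyps)
      show "card (I - {i}) < card I" using fin i by (rule card_Diff1_less)
      fix J assume J: "J \<subseteq> I - {i}"
      show "card J \<le> card (\<Union>j\<in>J. A j - {x})"
      proof (cases "J = {}")
        case False
        then have "card J < card (\<Union>(A ` J))" using J i 2(2)[of J] by blast
        moreover have eq: "(\<Union>j\<in>J. A j - {x}) = \<Union>(A ` J) - {x}" by blast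
        moreover have "card (\<Union>(A ` J)) - 1 \<le> card (\<Union>(A ` J) - {x})"
          by (simp add: card_Diff_singleton_if)
        ultimately show ?thesis unfolding eq by linarith
      qed simp
    qed (use fin finA in auto)
    then obtain f where f: "inj_on f (I - {i})" "\<forall>j\<in>I - {i}. f j \<in> A j - {x}" by blast
    have "inj_on (f(i := x)) I" using f by (auto simp: inj_on_def)
    moreover have "\<forall>j\<in>I. (f(i := x)) j \<in> A j" using f x by auto
    ultimately show ?thesis by blast
  next
    case 3
    have finJ: "finite J" using 3 fin finite_subset by blast
    have finU: "finite (\<Union>(A ` J))" using 3 finJ finA by blast
    have "\<exists>f. inj_on f J \<and> (\<forall>j\<in>J. f j \<in> A j)"
    proof (rule less.hyps)
      show "card J < card I" using fin 3 psubset_card_mono by blast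
    qed (use 3 finJ finA hall in auto)
    then obtain f where f: "inj_on f J" "\<forall>j\<in>J. f j \<in> A j" by blast
    have "\<exists>g. inj_on g (I - J) \<and> (\<forall>j\<in>I - J. g j \<in> A j - \<Union>(A ` J))"
    proof (rule less.hyps)
      show "card (I - J) < card I" using fin 3 by (intro psubset_card_mono) auto
      fix L assume L: "L \<subseteq> I - J"
      have finL: "finite L" using L fin finite_subset by blast
      have finLU: "finite (\<Union>l\<in>L. A l - \<Union>(A ` J))" using L finL finA by blast
      have "card L + card J = card (L \<union> J)"
        using L finL finJ by (intro card_Un_disjoint[symmetric]) auto
      also have "\<dots> \<le> card (\<Union>(A ` (L \<union> J)))" using hall[of "L \<union> J"] L 3 by blast
      also have "\<Union>(A ` (L \<union> J)) = (\<Union>l\<in>L. A l - \<Union>(A ` J)) \<union> \<Union>(A ` J)" by blast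
      also have "card \<dots> = card (\<Union>l\<in>L. A l - \<Union>(A ` J)) + card (\<Union>(A ` J))"
        using finLU finU by (intro card_Un_disjoint) auto
      finally show "card L \<le> card (\<Union>l\<in>L. A l - \<Union>(A ` J))" using 3 by simp
    qed (use fin finA in auto)
    then obtain g where g: "inj_on g (I - J)" "\<forall>j\<in>I - J. g j \<in> A j - \<Union>(A ` J)" by blast
    define h where "h = (\<lambda>j. if j \<in> J then f j else g j)"
    have sep: False if "i \<in> J" "j \<in> I - J" "f i = g j" for i j
      using that f g by (metis DiffD2 UN_I)
    have "inj_on h I"
    proof (rule inj_onI)
      fix i j assume "i \<in> I" "j \<in> I" "h i = h j"
      then show "i = j"
        using f g sep[of i j] sep[of j i] unfolding h_def inj_on_def
        by (auto split: if_splits)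
    qed
    moreover have "\<forall>i\<in>I. h i \<in> A i" using f g unfolding h_def by auto
    ultimately show ?thesis by blast
  qed
qed

definition quads :: "'a set \<Rightarrow> 'a set set" where
  "quads V = {A. A \<subseteq> V \<and> card A = 4}"

definition pairs :: "'a set \<Rightarrow> 'a set set" where
  "pairs C = {p. p \<subseteq> C \<and> card p = 2}"

definition berge_core :: "'a set set \<Rightarrow> 'a set \<Rightarrow> bool" where
  "berge_core F C \<longleftrightarrow> (\<exists>\<psi>. inj_on \<psi> (pairs C) \<and> (\<forall>p\<in>pairs C. \<psi> p \<in> F \<and> p \<subseteq> \<psi> p))"

definition covering :: "'a set set \<Rightarrow> 'a set set \<Rightarrow> 'a set set" where
  "covering F S = {A \<in> F. \<exists>p\<in>S. p \<subseteq> A}"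

lemma finite_quads [simp]: "finite V \<Longrightarrow> finite (quads V)"
  unfolding quads_def by simp

lemma finite_pairs [simp]: "finite V \<Longrightarrow> finite (pairs V)"
  unfolding pairs_def by simp

lemma card_quads: "finite V \<Longrightarrow> card (quads V) = card V choose 4"
  unfolding quads_def by (rule n_subsets)

lemma card_pairs: "finite V \<Longrightarrow> card (pairs V) = card V choose 2"
  unfolding pairs_def by (rule n_subsets)

lemma finite_covering [simp]: "finite F \<Longrightarrow> finite (covering F S)"
  unfolding covering_def by simp

lemma pairs_mono: "C \<subseteq> D \<Longrightarrow> pairs C \<subseteq> pairs D"
  unfolding pairs_def by blast

lemma covering_mono: "S \<subseteq> T \<Longrightarrow> covering F S \<subseteq> covering F T"
  unfolding covering_def by blast

lemma pair_in_pairs [simp]: "{x, y} \<in> pairs C \<longleftrightarrow> x \<in> C \<and> y \<in> C \<and> x \<noteq> y"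
  unfolding pairs_def by (auto simp: card_insert_if)

lemma pairsE:
  assumes "p \<in> pairs C"
  obtains x y where "p = {x, y}" "x \<in> C" "y \<in> C" "x \<noteq> y"
  using assms unfolding pairs_def by (auto simp: card_2_iff)

lemma berge_core_subset:
  assumes "berge_core F C" "D \<subseteq> C"
  shows "berge_core F D"
proof -
  have "pairs D \<subseteq> pairs C" using assms(2) unfolding pairs_def by auto
  then show ?thesis using assms(1) unfolding berge_core_def by (meson inj_on_subset subsetD)
qed

lemma berge_core_mono:
  assumes "berge_core F C" "F \<subseteq> G"
  shows "berge_core G C"
  using assms unfolding berge_core_def by blast

lemma hall_violator:
  assumes "finite C" "finite F" "\<not> berge_core F C"
  obtains S where "S \<subseteq> pairs C" "card (covering F S) < card S"
proof (rule ccontr)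
  assume no: "\<not> thesis"
  have "\<exists>\<psi>. inj_on \<psi> (pairs C) \<and> (\<forall>p\<in>pairs C. \<psi> p \<in> {A \<in> F. p \<subseteq> A})"
  proof (rule hall_marriage)
    fix J assume "J \<subseteq> pairs C"
    then have "card J \<le> card (covering F J)" using no that by (meson not_le)
    moreover have "covering F J = (\<Union>p\<in>J. {A \<in> F. p \<subseteq> A})" unfolding covering_def by blast
    ultimately show "card J \<le> card (\<Union>p\<in>J. {A \<in> F. p \<subseteq> A})" by simp
  qed (use assms in auto)
  then have "berge_core F C" unfolding berge_core_def by auto
  then show False using assms by blast
qed

text \<open>Double counting with weight 2 on the quadruples through \<open>u\<close>: these contain only 3 pairs of the
  core, the others contain 6.\<close>

lemma berge_core_if_degrees:
  assumes V: "finite V" and F: "F \<subseteq> quads V"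
    and deg: "\<And>p. p \<in> pairs (V - {u}) \<Longrightarrow>
      6 \<le> card {A \<in> F. p \<subseteq> A} + card {A \<in> F. p \<subseteq> A \<and> u \<in> A}"
  shows "berge_core F (V - {u})"
proof (rule ccontr)
  have finF: "finite F" using F V finite_subset by fastforce
  assume "\<not> berge_core F (V - {u})"
  then obtain S where S: "S \<subseteq> pairs (V - {u})" "card (covering F S) < card S"
    using hall_violator[of "V - {u}" F] V finF by blast
  have finS: "finite S" using S V finite_subset by fastforce
  define w :: "'a set \<Rightarrow> nat" where "w = (\<lambda>A. if u \<in> A then 2 else 1)"
  have wsum: "card {A \<in> F. p \<subseteq> A} + card {A \<in> F. p \<subseteq> A \<and> u \<in> A} = (\<Sum>A\<in>{A \<in> F. p \<subseteq> A}. w A)" for p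
  proof -
    have "(\<Sum>A\<in>{A \<in> F. p \<subseteq> A}. w A) = (\<Sum>A\<in>{A \<in> F. p \<subseteq> A}. 1 + (if u \<in> A then 1 else 0))"
      unfolding w_def by (intro sum.cong) auto
    also have "\<dots> = card {A \<in> F. p \<subseteq> A} + (\<Sum>A\<in>{A \<in> F. p \<subseteq> A}. if u \<in> A then 1 else 0)"
      by (simp only: sum.distrib card_eq_sum)
    also have "(\<Sum>A\<in>{A \<in> F. p \<subseteq> A}. if u \<in> A then 1 else 0) = card {A \<in> F. p \<subseteq> A \<and> u \<in> A}"
      using finF by (subst sum.inter_filter[symmetric]) (auto intro!: arg_cong[where f = card])
    finally show ?thesis by simp
  qed
  have bound: "w A * card {p \<in> S. p \<subseteq> A} \<le> 6" if "A \<in> F" for A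
  proof -
    have A: "finite A" "card A = 4"
      using that F V finite_subset[of A V] unfolding quads_def by auto
    have "{p \<in> S. p \<subseteq> A} \<subseteq> pairs (A - {u})" using S unfolding pairs_def by blast
    then have "card {p \<in> S. p \<subseteq> A} \<le> card (pairs (A - {u}))" using A by (intro card_mono) auto
    also have "\<dots> = card (A - {u}) choose 2" using A by (simp add: card_pairs)
    finally show ?thesis using A unfolding w_def
      by (auto simp: card_Diff_singleton_if numeral_eq_Suc split: if_splits)
  qed
  have "6 * card S = (\<Sum>p\<in>S. 6)" by simp
  also have "\<dots> \<le> (\<Sum>p\<in>S. \<Sum>A\<in>{A \<in> F. p \<subseteq> A}. w A)"
    using deg S by (intro sum_mono) (auto simp: wsum[symmetric])
  also have "\<dots> = (\<Sum>p\<in>S. \<Sum>A\<in>{A \<in> covering F S. p \<subseteq> A}. w A)"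
    unfolding covering_def by (intro sum.cong) auto
  also have "\<dots> = (\<Sum>A\<in>covering F S. \<Sum>p\<in>{p \<in> S. p \<subseteq> A}. w A)"
    using finS finF by (intro sum.swap_restrict) auto
  also have "\<dots> \<le> (\<Sum>A\<in>covering F S. 6)"
    using bound by (intro sum_mono) (auto simp: covering_def mult.commute)
  also have "\<dots> = 6 * card (covering F S)" by simp
  finally show False using S by simp
qed

text \<open>The quadruples of \<open>F\<close> through \<open>v\<close> do not suffice to represent the pairs \<open>{v, x}\<close> with
  \<open>x \<in> X\<close>.\<close>

definition deficient_star :: "'a set set \<Rightarrow> 'a \<Rightarrow> 'a set \<Rightarrow> bool" where
  "deficient_star F v X \<longleftrightarrow> card {A \<in> F. v \<in> A \<and> A \<inter> X \<noteq> {}} < card X"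

lemma berge_core_insert:
  assumes "finite C" "finite F" "v \<notin> C" "berge_core {A \<in> F. v \<notin> A} C"
    and "\<not> berge_core F (insert v C)"
  obtains X where "X \<subseteq> C" "deficient_star F v X"
proof (rule ccontr)
  assume no: "\<not> thesis"
  have "\<exists>f. inj_on f C \<and> (\<forall>x\<in>C. f x \<in> {A \<in> F. v \<in> A \<and> x \<in> A})"
  proof (rule hall_marriage)
    fix X assume "X \<subseteq> C"
    then have "card X \<le> card {A \<in> F. v \<in> A \<and> A \<inter> X \<noteq> {}}"
      using no that unfolding deficient_star_def by (meson not_le)
    moreover have "{A \<in> F. v \<in> A \<and> A \<inter> X \<noteq> {}} = (\<Union>x\<in>X. {A \<in> F. v \<in> A \<and> x \<in> A})" by blast
    ultimately show "card X \<le> card (\<Union>x\<in>X. {A \<in> F. v \<in> A \<and> x \<in> A})" by simp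
  qed (use assms in auto)
  then obtain f where f: "inj_on f C" "\<And>x. x \<in> C \<Longrightarrow> f x \<in> F \<and> v \<in> f x \<and> x \<in> f x" by auto
  obtain \<psi> where \<psi>: "inj_on \<psi> (pairs C)"
      "\<And>p. p \<in> pairs C \<Longrightarrow> \<psi> p \<in> F \<and> v \<notin> \<psi> p \<and> p \<subseteq> \<psi> p"
    using assms(4) unfolding berge_core_def by auto
  define \<chi> where "\<chi> = (\<lambda>p. if v \<in> p then f (the_elem (p - {v})) else \<psi> p)"
  have cases: "p \<in> pairs C \<and> v \<notin> p \<or> (\<exists>x\<in>C. p = {v, x})" if "p \<in> pairs (insert v C)" for p
    using that assms(3) by (auto elim!: pairsE)
  have \<chi>_star: "\<chi> {v, x} = f x" if "x \<in> C" for x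
  proof -
    have "{v, x} - {v} = {x}" using that assms(3) by auto
    then show ?thesis unfolding \<chi>_def by simp
  qed
  have \<chi>_in: "\<chi> p = \<psi> p" if "v \<notin> p" for p using that unfolding \<chi>_def by simp
  have "inj_on \<chi> (pairs (insert v C))"
  proof (rule inj_onI)
    fix p q assume "p \<in> pairs (insert v C)" "q \<in> pairs (insert v C)" and eq: "\<chi> p = \<chi> q"
    have sep: "\<chi> r \<noteq> \<chi> {v, x}" if "r \<in> pairs C" "v \<notin> r" "x \<in> C" for r x
      using that \<psi>(2)[of r] f(2)[of x] by (auto simp: \<chi>_star \<chi>_in)
    from \<open>p \<in> _\<close>[THEN cases] \<open>q \<in> _\<close>[THEN cases] show "p = q"
    proof (elim disjE bexE conjE)
      assume "p \<in> pairs C" "v \<notin> p" "q \<in> pairs C" "v \<notin> q"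
      then show ?thesis using eq \<psi>(1) by (simp add: \<chi>_in inj_on_eq_iff)
    next
      fix x y assume "x \<in> C" "p = {v, x}" "y \<in> C" "q = {v, y}"
      then show ?thesis using eq f(1) by (simp add: \<chi>_star inj_on_eq_iff)
    qed (use eq sep in metis)+
  qed
  moreover have "\<chi> p \<in> F \<and> p \<subseteq> \<chi> p" if "p \<in> pairs (insert v C)" for p
    using cases[OF that] \<psi>(2)[of p] f(2) by (auto simp: \<chi>_star \<chi>_in)
  ultimately have "berge_core F (insert v C)" unfolding berge_core_def by blast
  then show False using assms by blast
qed

section \<open>Deficient stars\<close>

lemma card_star:
  assumes "finite U" "z \<in> U"
  shows "card ((\<lambda>q. {z, q}) ` (U - {z})) = card U - 1"
proof -
  have "inj_on (\<lambda>q. {z, q}) (U - {z})" by (auto simp: inj_on_def doubleton_eq_iff)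
  then show ?thesis using assms by (simp add: card_image)
qed

lemma card_pairs_meeting:
  assumes U: "finite U" "6 \<le> card U" and XY: "X \<subseteq> U" "Y \<subseteq> U" "2 \<le> card X" "2 \<le> card Y"
  shows "card X + card Y \<le> card {p \<in> pairs U. p \<inter> X \<noteq> {} \<and> p \<inter> Y \<noteq> {}} + 1"
proof -
  let ?M = "{p \<in> pairs U. p \<inter> X \<noteq> {} \<and> p \<inter> Y \<noteq> {}}"
  define st where "st = (\<lambda>z. (\<lambda>q. {z, q}) ` (U - {z}))"
  have finM: "finite ?M" using U by simp
  have fin: "finite X" "finite Y" using U XY finite_subset by blast+
  have st: "st z \<subseteq> ?M" "card (st z) = card U - 1" "finite (st z)" if "z \<in> X \<inter> Y" for z
    using that U XY card_star[of U z] unfolding st_def by auto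
  have st_int: "st z \<inter> st z' \<subseteq> {{z, z'}}" if "z \<noteq> z'" for z z'
    using that unfolding st_def by (auto simp: doubleton_eq_iff)
  have int: "card (st z \<inter> st z') \<le> 1" if "z \<noteq> z'" for z z'
    using card_mono[OF _ st_int[OF that]] by simp
  have XYun: "card X + card Y = card (X \<union> Y) + card (X \<inter> Y)"
    using fin by (rule card_Un_Int)
  have un: "card (X \<union> Y) \<le> card U" using U XY by (intro card_mono) auto
  have two: "2 * card U \<le> card (st z \<union> st z') + 3" if "z \<in> X \<inter> Y" "z' \<in> X \<inter> Y" "z \<noteq> z'" for z z'
    using card_Un_Int[of "st z" "st z'"] st[OF that(1)] st[OF that(2)] int[OF that(3)] U by linarith
  consider "X \<inter> Y = {}" | z where "X \<inter> Y = {z}" | "card (X \<inter> Y) = 2" | "3 \<le> card (X \<inter> Y)"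
  proof -
    have "card (X \<inter> Y) = 0 \<or> card (X \<inter> Y) = 1 \<or> card (X \<inter> Y) = 2 \<or> 3 \<le> card (X \<inter> Y)" by linarith
    then show ?thesis using that fin by (auto simp: card_1_singleton_iff)
  qed
  then show ?thesis
  proof cases
    case 1
    have "inj_on (\<lambda>(x, y). {x, y}) (X \<times> Y)"
      using 1 by (auto simp: inj_on_def doubleton_eq_iff)
    then have "card ((\<lambda>(x, y). {x, y}) ` (X \<times> Y)) = card X * card Y"
      by (simp add: card_image card_cartesian_product)
    moreover have "card ((\<lambda>(x, y). {x, y}) ` (X \<times> Y)) \<le> card ?M"
      using 1 XY finM by (intro card_mono) auto
    ultimately have "card X * card Y \<le> card ?M" by simp
    moreover obtain i j where "card X = i + 2" "card Y = j + 2"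
      using XY by (metis add.commute le_iff_add)
    ultimately show ?thesis by (simp add: algebra_simps)
  next
    case 2
    have "\<not> X \<subseteq> {z}" "\<not> Y \<subseteq> {z}"
      using card_mono[of "{z}" X] card_mono[of "{z}" Y] XY by auto
    then obtain x y where x: "x \<in> X" "x \<noteq> z" and y: "y \<in> Y" "y \<noteq> z" by blast
    have z: "z \<in> X \<inter> Y" using 2 by blast
    have "x \<noteq> y" using 2 x y by blast
    then have "insert {x, y} (st z) \<subseteq> ?M" using x y XY st[OF z] by auto
    then have "card (insert {x, y} (st z)) \<le> card ?M" using finM by (rule card_mono[rotated])
    moreover have "z \<in> p" if "p \<in> st z" for p using that unfolding st_def by auto
    then have "{x, y} \<notin> st z" using x y by blast
    ultimately show ?thesis using st[OF z] XYun un U 2 by simp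
  next
    case 3
    then obtain z z' where z: "z \<in> X \<inter> Y" "z' \<in> X \<inter> Y" "z \<noteq> z'" by (auto simp: card_2_iff)
    have "card (st z \<union> st z') \<le> card ?M" using st z finM by (intro card_mono) auto
    then show ?thesis using two[OF z] XYun un U 3 by linarith
  next
    case 4
    then obtain T where "T \<subseteq> X \<inter> Y" "card T = 3" by (meson obtain_subset_with_card_n)
    then obtain a b c where z: "a \<in> X \<inter> Y" "b \<in> X \<inter> Y" "c \<in> X \<inter> Y" "a \<noteq> b" "a \<noteq> c" "b \<noteq> c"
      by (auto simp: card_3_iff)
    have "card ((st a \<union> st b) \<inter> st c) \<le> card {{a, c}, {b, c}}"
      using st_int[OF z(5)] st_int[OF z(6)] by (intro card_mono) auto
    also have "\<dots> \<le> 2" by (simp add: card_insert_if)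
    finally have "3 * card U \<le> card (st a \<union> st b \<union> st c) + 6"
      using card_Un_Int[of "st a \<union> st b" "st c"] two[OF z(1,2,4)] st[OF z(1)] st[OF z(2)]
        st[OF z(3)] U
      by simp
    moreover have "card (st a \<union> st b \<union> st c) \<le> card ?M" using st z finM by (intro card_mono) auto
    moreover have "card X \<le> card U" "card Y \<le> card U" using XY U by (auto intro: card_mono)
    ultimately show ?thesis using U by linarith
  qed
qed

lemma card_pairs_meeting_singleton:
  assumes U: "finite U" and XY: "x \<in> U" "Y \<subseteq> U"
  shows "card Y \<le> card {p \<in> pairs U. p \<inter> {x} \<noteq> {} \<and> p \<inter> Y \<noteq> {}} + (if card Y = card U then 1 else 0)"
proof -
  let ?M = "{p \<in> pairs U. p \<inter> {x} \<noteq> {} \<and> p \<inter> Y \<noteq> {}}"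
  have finM: "finite ?M" using U by simp
  have le: "card Y \<le> card U" using XY U by (auto intro: card_mono)
  show ?thesis
  proof (cases "x \<in> Y")
    case True
    have "card ((\<lambda>q. {x, q}) ` (U - {x})) \<le> card ?M"
      using True XY finM by (intro card_mono) auto
    then show ?thesis using card_star[OF U XY(1)] le by auto
  next
    case False
    have "inj_on (\<lambda>q. {x, q}) Y" using False by (auto simp: inj_on_def doubleton_eq_iff)
    moreover have "card ((\<lambda>q. {x, q}) ` Y) \<le> card ?M"
      using False XY finM by (intro card_mono) auto
    ultimately show ?thesis by (simp add: card_image)
  qed
qed

lemma card_pairs_meeting_tight:
  assumes U: "finite U" "6 \<le> card U" and XY: "X \<subseteq> U" "Y \<subseteq> U" "X \<noteq> {}" "Y \<noteq> {}"
    and D: "card {p \<in> pairs U. p \<inter> X \<noteq> {} \<and> p \<inter> Y \<noteq> {}} + 2 \<le> card X + card Y"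
  shows "card X = 1 \<and> card Y = card U \<or> card Y = 1 \<and> card X = card U"
proof -
  have fin: "finite X" "finite Y" using U XY finite_subset by blast+
  then have "card X \<noteq> 0" "card Y \<noteq> 0" using XY by auto
  then have "card X = 1 \<or> card Y = 1 \<or> 2 \<le> card X \<and> 2 \<le> card Y" by linarith
  then consider x where "X = {x}" | y where "Y = {y}" | "2 \<le> card X" "2 \<le> card Y"
    unfolding One_nat_def card_1_singleton_iff by blast
  then show ?thesis
  proof cases
    case 1
    then show ?thesis using card_pairs_meeting_singleton[OF U(1), of x Y] XY D
      by (auto split: if_splits)
  next
    case 2
    have "{p \<in> pairs U. p \<inter> X \<noteq> {} \<and> p \<inter> Y \<noteq> {}} = {p \<in> pairs U. p \<inter> {y} \<noteq> {} \<and> p \<inter> X \<noteq> {}}"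
      using 2 by blast
    then show ?thesis using card_pairs_meeting_singleton[OF U(1), of y X] XY D 2
      by (auto split: if_splits)
  next
    case 3
    then show ?thesis using card_pairs_meeting[OF U XY(1,2)] D by linarith
  qed
qed

text \<open>A quadruple through \<open>v\<close> and \<open>w\<close> is determined by its other two points; it meets \<open>X\<close>
  automatically if \<open>w \<in> X\<close>, so that \<open>X\<close> may be replaced by all of \<open>V - {v, w}\<close>.\<close>

lemma card_quads_through:
  assumes V: "finite V" and vw: "v \<in> V" "w \<in> V" "v \<noteq> w"
  shows "card {p \<in> pairs (V - {v, w}). p \<inter> (if w \<in> X then V - {v, w} else X) \<noteq> {} \<and>
                 p \<inter> (if v \<in> Y then V - {v, w} else Y) \<noteq> {}}
    \<le> card {A \<in> quads V. v \<in> A \<and> w \<in> A \<and> A \<inter> X \<noteq> {} \<and> A \<inter> Y \<noteq> {}}" (is "card ?M \<le> card ?D")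
proof (rule card_inj_on_le)
  let ?f = "\<lambda>p. insert v (insert w p)"
  show "inj_on ?f ?M"
  proof (rule inj_onI)
    fix p q assume "p \<in> ?M" "q \<in> ?M" and eq: "?f p = ?f q"
    then have "?f p - {v, w} = p" "?f q - {v, w} = q" unfolding pairs_def by auto
    then show "p = q" using eq by metis
  qed
  have "?f p \<in> ?D" if "p \<in> ?M" for p
  proof -
    have p: "p \<subseteq> V - {v, w}" "card p = 2" using that unfolding pairs_def by auto
    have "finite p" using p V finite_subset by blast
    moreover have "w \<notin> p" "v \<notin> p" using p by auto
    ultimately have "card (?f p) = 4" using p vw by simp
    then show ?thesis using p that vw unfolding quads_def by (auto split: if_splits)
  qed
  then show "?f ` ?M \<subseteq> ?D" by blast
  show "finite ?D" using V by simp
qed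

lemma deficient_stars_opposite:
  assumes V: "finite V" "8 \<le> card V" and vw: "v \<in> V" "w \<in> V" "v \<noteq> w" and F: "F \<subseteq> quads V"
    and X: "X \<subseteq> V - {v}" "card X \<le> card V - 2" "deficient_star F v X"
    and Y: "Y \<subseteq> V - {w}" "card Y \<le> card V - 2" "deficient_star (quads V - F) w Y"
  shows "(\<exists>x. X = {x} \<and> x \<noteq> w \<and> card Y = card V - 2) \<or> (\<exists>y. Y = {y} \<and> y \<noteq> v \<and> card X = card V - 2)"
proof -
  let ?U = "V - {v, w}"
  let ?X = "if w \<in> X then ?U else X" and ?Y = "if v \<in> Y then ?U else Y"
  let ?D = "{A \<in> quads V. v \<in> A \<and> w \<in> A \<and> A \<inter> X \<noteq> {} \<and> A \<inter> Y \<noteq> {}}"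
  have U: "finite ?U" "card ?U = card V - 2" using V vw by (auto simp: card_Diff_subset)
  have finF: "finite F" using V F finite_subset by fastforce
  have "card ?D \<le> card (?D \<inter> F) + card (?D - F)"
    using card_Un_le[of "?D \<inter> F" "?D - F"] by (simp add: Int_Diff_Un)
  moreover have "card (?D \<inter> F) \<le> card {A \<in> F. v \<in> A \<and> A \<inter> X \<noteq> {}}"
    using finF by (intro card_mono) auto
  moreover have "card (?D - F) \<le> card {A \<in> quads V - F. w \<in> A \<and> A \<inter> Y \<noteq> {}}"
    using V by (intro card_mono) auto
  ultimately have D: "card ?D + 2 \<le> card X + card Y"
    using X(3) Y(3) unfolding deficient_star_def by linarith
  have ne: "X \<noteq> {}" "Y \<noteq> {}" using X(3) Y(3) unfolding deficient_star_def by auto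
  have Une: "?U \<noteq> {}"
  proof
    assume "?U = {}"
    then have "card ?U = 0" by (simp only: card.empty)
    then show False using U V by linarith
  qed
  have X': "?X \<subseteq> ?U" "?X \<noteq> {}" "card X \<le> card ?X"
    using X U V ne Une by auto
  have Y': "?Y \<subseteq> ?U" "?Y \<noteq> {}" "card Y \<le> card ?Y"
    using Y U V ne Une by auto
  have "card ?X = 1 \<and> card ?Y = card ?U \<or> card ?Y = 1 \<and> card ?X = card ?U"
    using D card_quads_through[OF V(1) vw, of X Y] U V X' Y'
    by (intro card_pairs_meeting_tight) auto
  then show ?thesis
  proof (elim disjE conjE)
    assume *: "card ?X = 1" "card ?Y = card ?U"
    have "w \<notin> X" using * U V by (auto split: if_splits)
    then obtain x where x: "X = {x}" using * by (auto simp: card_1_singleton_iff)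
    have "card V - 2 \<le> card ?D + 1"
      using card_pairs_meeting_singleton[OF U(1), of x ?Y] * U X' Y' x \<open>w \<notin> X\<close>
        card_quads_through[OF V(1) vw, of X Y]
      by (auto simp del: Int_insert_right split: if_splits)
    then show ?thesis using D x \<open>w \<notin> X\<close> Y(2) by auto
  next
    assume *: "card ?Y = 1" "card ?X = card ?U"
    have "v \<notin> Y" using * U V by (auto split: if_splits)
    then obtain y where y: "Y = {y}" using * by (auto simp: card_1_singleton_iff)
    have "{p \<in> pairs ?U. p \<inter> ?X \<noteq> {} \<and> p \<inter> {y} \<noteq> {}} = {p \<in> pairs ?U. p \<inter> {y} \<noteq> {} \<and> p \<inter> ?X \<noteq> {}}"
      by blast
    then have "card V - 2 \<le> card ?D + 1"
      using card_pairs_meeting_singleton[OF U(1), of y ?X] * U X' Y' y \<open>v \<notin> Y\<close>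
        card_quads_through[OF V(1) vw, of X Y]
      by (auto simp del: Int_insert_right split: if_splits)
    then show ?thesis using D y \<open>v \<notin> Y\<close> X(2) by auto
  qed
qed

lemma deficient_star_singleton:
  assumes "finite F"
  shows "deficient_star F v {x} \<longleftrightarrow> (\<forall>A\<in>F. v \<in> A \<longrightarrow> x \<notin> A)"
  using assms unfolding deficient_star_def by auto

lemma full_star_edges:
  assumes V: "finite V" "8 \<le> card V" and vxw: "v \<in> V" "x \<in> V" "w \<in> V" "v \<noteq> x" "v \<noteq> w" "x \<noteq> w"
    and G: "G \<subseteq> quads V" "\<And>A. A \<in> quads V \<Longrightarrow> v \<in> A \<Longrightarrow> x \<in> A \<Longrightarrow> A \<in> G"
    and Y: "Y \<subseteq> V - {w}" "card Y = card V - 2" "deficient_star G w Y"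
    and A: "A \<in> G" "w \<in> A"
  shows "v \<in> A \<and> x \<in> A"
proof -
  let ?Z = "{A \<in> G. w \<in> A \<and> A \<inter> Y \<noteq> {}}"
  let ?Q = "(\<lambda>q. {v, x, w, q}) ` (V - {v, x, w})"
  have finG: "finite G" using V G finite_subset by fastforce
  have meet: "A \<inter> Y \<noteq> {}" if "A \<in> quads V" "w \<in> A" for A
  proof
    assume "A \<inter> Y = {}"
    then have sub: "A - {w} \<subseteq> (V - {w}) - Y" using that unfolding quads_def by auto
    have "card (A - {w}) = 3" using that unfolding quads_def by (simp add: card_Diff_singleton)
    moreover have "card ((V - {w}) - Y) = 1"
      using Y V vxw finite_subset[OF Y(1)] by (simp add: card_Diff_subset)
    ultimately show False using card_mono[OF _ sub] V by simp
  qed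
  have "inj_on (\<lambda>q. {v, x, w, q}) (V - {v, x, w})" by (auto simp: inj_on_def)
  then have "card ?Q = card (V - {v, x, w})" by (rule card_image)
  also have "\<dots> = card V - 3" using V vxw by (simp add: card_Diff_subset)
  finally have card0: "card ?Q = card V - 3" .
  have quad: "{v, x, w, q} \<in> quads V" if "q \<in> V - {v, x, w}" for q
    using that vxw unfolding quads_def by auto
  have "?Q \<subseteq> ?Z" using G(2)[OF quad] meet[OF quad] by auto
  moreover have "card ?Z \<le> card ?Q" using card0 Y unfolding deficient_star_def by simp
  ultimately have "?Q = ?Z" by (rule card_seteq[rotated]) (use finG in simp)
  moreover have "A \<in> ?Z" using A meet G by auto
  ultimately show ?thesis by blast
qed

lemma berge_core_if_quads_avoiding:
  assumes V: "finite V" "8 \<le> card V" and v: "v \<in> V" and F: "F \<subseteq> quads V" "quads (V - {v}) \<subseteq> F"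
  shows "berge_core F (V - {v})"
proof (rule berge_core_if_degrees)
  fix p assume p: "p \<in> pairs (V - {v})"
  have p2: "finite p" "card p = 2" "p \<subseteq> V" "v \<notin> p" using p V finite_subset[of p V] unfolding pairs_def by auto
  let ?W = "V - {v} - p"
  have "p \<subseteq> V - {v}" using p2 by blast
  then have W: "finite ?W" "card ?W = card V - 3" using V p2 v by (simp_all add: card_Diff_subset)
  have "(\<lambda>q. p \<union> q) ` pairs ?W \<subseteq> {A \<in> F. p \<subseteq> A}"
  proof -
    have "p \<union> q \<in> quads (V - {v})" if "q \<in> pairs ?W" for q
    proof -
      have q: "q \<subseteq> ?W" "card q = 2" using that unfolding pairs_def by auto
      then have "finite q" using W finite_subset by blast
      then have "card (p \<union> q) = 4" using q p2 by (subst card_Un_disjoint) auto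
      then show ?thesis using q p2 unfolding quads_def by auto
    qed
    then show ?thesis using F by auto
  qed
  moreover have "inj_on (\<lambda>q. p \<union> q) (pairs ?W)" unfolding inj_on_def pairs_def by blast
  moreover have "finite {A \<in> F. p \<subseteq> A}" using F V finite_subset[of F] by auto
  ultimately have "card (pairs ?W) \<le> card {A \<in> F. p \<subseteq> A}" by (intro card_inj_on_le)
  moreover have "5 choose 2 \<le> card ?W choose 2" using V W by (intro binomial_right_mono) auto
  ultimately show "6 \<le> card {A \<in> F. p \<subseteq> A} + card {A \<in> F. p \<subseteq> A \<and> v \<in> A}"
    using W by (simp add: card_pairs numeral_eq_Suc)
qed (use assms in auto)

definition has_deficient_star :: "'a set \<Rightarrow> 'a set set \<Rightarrow> 'a \<Rightarrow> bool" where
  "has_deficient_star V F v \<longleftrightarrow>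
     (\<exists>X. X \<subseteq> V - {v} \<and> card X \<le> card V - 2 \<and> deficient_star F v X)"

lemma berge_core_if_exceptional_stars:
  assumes V: "finite V" "8 \<le> card V" and vxw: "v \<in> V" "x \<in> V" "w \<in> V" "v \<noteq> x" "v \<noteq> w" "x \<noteq> w"
    and F: "F \<subseteq> quads V" "deficient_star F v {x}"
    and Y: "Y \<subseteq> V - {w}" "card Y = card V - 2" "deficient_star (quads V - F) w Y"
    and stars: "\<And>u. u \<in> V \<Longrightarrow> has_deficient_star V F u \<or> has_deficient_star V (quads V - F) u"
  shows "berge_core F (V - {v})"
proof -
  let ?G = "quads V - F"
  have finF: "finite F" using V F finite_subset by fastforce
  have GI: "A \<in> ?G" if "deficient_star F a {b}" "A \<in> quads V" "a \<in> A" "b \<in> A" for a b A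
    using that deficient_star_singleton[OF finF] by auto
  have atw: "v \<in> A \<and> x \<in> A" if "A \<in> ?G" "w \<in> A" for A
    using full_star_edges[OF V vxw _ _ Y, of A] GI[OF F(2)] that by auto
  have key: "v \<in> A \<and> x \<in> A" if A: "A \<in> ?G" "u \<in> A" and u: "u \<in> V" "u \<noteq> v" "u \<noteq> x" for A u
  proof (cases "u = w")
    case True
    then show ?thesis using A atw by blast
  next
    case False
    have "has_deficient_star V F u \<or> has_deficient_star V ?G u" using stars u by blast
    then show ?thesis
    proof
      assume "has_deficient_star V F u"
      then obtain X where X: "X \<subseteq> V - {u}" "card X \<le> card V - 2" "deficient_star F u X"
        unfolding has_deficient_star_def by blast
      have "\<exists>y. X = {y} \<and> y \<noteq> w"
        using deficient_stars_opposite[OF V u(1) vxw(3) False F(1) X Y(1) _ Y(3)] Y(2) V by auto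
      then obtain y where y: "X = {y}" "y \<noteq> w" by blast
      have yV: "y \<in> V" "y \<noteq> u" using X y by auto
      have "{v, x} \<subseteq> {u, y, w, q}" if "q \<in> V - {u, y, w}" for q
      proof -
        have "{u, y, w, q} \<in> quads V" using that u yV y vxw False unfolding quads_def by auto
        then have "{u, y, w, q} \<in> ?G" using GI[of u y] X y by auto
        then show ?thesis using atw[of "{u, y, w, q}"] by auto
      qed
      then have *: "v \<in> {u, y, w, q} \<and> x \<in> {u, y, w, q}" if "q \<in> V - {u, y, w}" for q
        using that by auto
      have "card (set [u, y, w, v, x]) < card V"
        by (rule le_less_trans[OF card_length]) (use V in simp)
      then have "\<not> V \<subseteq> set [u, y, w, v, x]" using card_mono[OF finite_set] leD by blast
      then obtain q where q: "q \<in> V" "q \<noteq> u" "q \<noteq> y" "q \<noteq> w" "q \<noteq> v" "q \<noteq> x" by auto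
      then show ?thesis using *[of q] u vxw by auto
    next
      assume "has_deficient_star V ?G u"
      then obtain Z where Z: "Z \<subseteq> V - {u}" "card Z \<le> card V - 2" "deficient_star ?G u Z"
        unfolding has_deficient_star_def by blast
      have "Suc 0 \<le> card V - 2" "Suc 0 \<noteq> card V - 2" using V by auto
      then have "card Z = card V - 2"
        using deficient_stars_opposite[OF V vxw(1) u(1) _ F(1) _ _ F(2) Z] u vxw V by auto
      then show ?thesis
        using full_star_edges[OF V vxw(1,2) u(1) vxw(4) _ _ _ _ Z(1) _ Z(3), of A]
          GI[OF F(2)] A u by auto
    qed
  qed
  have "quads (V - {v}) \<subseteq> F"
  proof
    fix A assume A: "A \<in> quads (V - {v})"
    then have "card (A - {x}) \<noteq> 0" unfolding quads_def by (auto simp: card_Diff_singleton_if)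
    then have "A - {x} \<noteq> {}" by force
    then obtain u where u: "u \<in> A" "u \<noteq> x" by blast
    show "A \<in> F"
    proof (rule ccontr)
      assume "A \<notin> F"
      then have "A \<in> ?G" using A unfolding quads_def by auto
      then show False using key[of A u] u A unfolding quads_def by auto
    qed
  qed
  then show ?thesis using berge_core_if_quads_avoiding[OF V vxw(1) F(1)] by blast
qed

lemma berge_core_if_all_deficient:
  assumes V: "finite V" "8 \<le> card V" and F: "F \<subseteq> quads V" and u: "u \<in> V"
    and stars: "\<And>v. v \<in> V \<Longrightarrow> has_deficient_star V F v"
  shows "berge_core (quads V - F) (V - {u})"
proof (rule berge_core_if_degrees)
  let ?G = "quads V - F"
  have finF: "finite F" using V F finite_subset by fastforce
  fix p assume "p \<in> pairs (V - {u})"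
  then obtain x y where p: "p = {x, y}" and xy: "x \<in> V" "y \<in> V" "x \<noteq> y" "x \<noteq> u" "y \<noteq> u"
    by (auto elim!: pairsE)
  obtain X where X: "X \<subseteq> V - {x}" "card X \<le> card V - 2" "deficient_star F x X"
    using stars[OF xy(1)] unfolding has_deficient_star_def by blast
  have "X \<noteq> {}" using X(3) unfolding deficient_star_def by auto
  let ?U = "V - {x, y}"
  let ?X = "if y \<in> X then ?U else X"
  let ?D = "{A \<in> quads V. x \<in> A \<and> y \<in> A \<and> A \<inter> X \<noteq> {} \<and> A \<inter> {x} \<noteq> {}}"
  have U: "finite ?U" "card ?U = card V - 2" using V xy by (auto simp: card_Diff_subset)
  have D: "card {q \<in> pairs ?U. q \<inter> ?X \<noteq> {} \<and> q \<inter> ?U \<noteq> {}} \<le> card ?D"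
    using card_quads_through[OF V(1) xy(1-3), of X "{x}"] by simp
  have "card (?D \<inter> F) \<le> card {A \<in> F. x \<in> A \<and> A \<inter> X \<noteq> {}}"
    using finF by (intro card_mono) auto
  then have DF: "card (?D \<inter> F) < card X" using X(3) unfolding deficient_star_def by linarith
  have "card ?D \<le> card (?D \<inter> F) + card (?D - F)"
    using card_Un_le[of "?D \<inter> F" "?D - F"] by (simp add: Int_Diff_Un)
  moreover have DG: "card (?D - F) \<le> card {A \<in> ?G. p \<subseteq> A}"
    using V p by (intro card_mono) auto
  ultimately have le: "card ?D + 1 \<le> card {A \<in> ?G. p \<subseteq> A} + card X" using DF by linarith
  show "6 \<le> card {A \<in> ?G. p \<subseteq> A} + card {A \<in> ?G. p \<subseteq> A \<and> u \<in> A}"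
  proof (cases "2 \<le> card ?X")
    case True
    have X': "?X \<subseteq> ?U" "card X \<le> card ?X" using X U by auto
    have "card ?X + card ?U \<le> card ?D + 1"
      using card_pairs_meeting[OF U(1) _ X'(1) order.refl True] D U V by linarith
    then show ?thesis using le X' U V by linarith
  next
    case False
    then have "y \<notin> X" using U V by auto
    moreover have "card X \<noteq> 0" using \<open>X \<noteq> {}\<close> X V finite_subset[OF X(1)] by auto
    ultimately have "card X = 1" using False by simp
    then obtain z where z: "X = {z}" by (auto simp: card_1_singleton_iff)
    have zV: "z \<in> V" "z \<noteq> x" "z \<noteq> y" using z X \<open>y \<notin> X\<close> by auto
    have inG: "insert q {x, y, z} \<in> {A \<in> ?G. p \<subseteq> A}" if "q \<in> V - {x, y, z}" for q
    proof -
      have "insert q {x, y, z} \<in> quads V" using that zV xy unfolding quads_def by auto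
      moreover have "insert q {x, y, z} \<notin> F"
        using X(3) z deficient_star_singleton[OF finF] by auto
      ultimately show ?thesis using p by auto
    qed
    let ?Q = "(\<lambda>q. insert q {x, y, z}) ` (V - {x, y, z})"
    have "inj_on (\<lambda>q. insert q {x, y, z}) (V - {x, y, z})" by (auto simp: inj_on_def)
    then have "card ?Q = card (V - {x, y, z})" by (rule card_image)
    also have "\<dots> = card V - 3" using V xy zV by (simp add: card_Diff_subset)
    finally have "card V - 3 = card ?Q" ..
    also have "\<dots> \<le> card {A \<in> ?G. p \<subseteq> A}"
      using inG V by (intro card_mono) auto
    finally have five: "5 \<le> card {A \<in> ?G. p \<subseteq> A}" using V by linarith
    have "{A \<in> ?G. p \<subseteq> A \<and> u \<in> A} \<noteq> {}"
    proof (cases "z = u")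
      case True
      have "card (V - {x, y, z}) \<noteq> 0" using V xy zV by (simp add: card_Diff_subset)
      then have "V - {x, y, z} \<noteq> {}" by force
      then obtain q where "q \<in> V - {x, y, z}" by blast
      then show ?thesis using inG[of q] True by blast
    next
      case False
      then show ?thesis using inG[of u] u xy by blast
    qed
    then have "1 \<le> card {A \<in> ?G. p \<subseteq> A \<and> u \<in> A}"
      using V by (simp add: Suc_le_eq card_gt_0_iff)
    then show ?thesis using five by linarith
  qed
qed (use V in auto)

lemma berge_core_step:
  assumes V: "finite V" "8 \<le> card V" and F: "F \<subseteq> quads V"
    and IH: "\<And>v. v \<in> V \<Longrightarrow> \<exists>C\<subseteq>V - {v}. card C = card V - 2 \<and>
      (berge_core {A \<in> F. v \<notin> A} C \<or> berge_core {A \<in> quads V - F. v \<notin> A} C)"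
  shows "\<exists>C\<subseteq>V. card C = card V - 1 \<and> (berge_core F C \<or> berge_core (quads V - F) C)"
proof (rule ccontr)
  let ?G = "quads V - F"
  assume "\<not> ?thesis"
  then have noF: "\<not> berge_core F C" and noG: "\<not> berge_core ?G C"
    if "C \<subseteq> V" "card C = card V - 1" for C using that by blast+
  have finF: "finite F" using V F finite_subset by fastforce
  have FG: "quads V - ?G = F" using F by blast
  have stars: "has_deficient_star V F v \<or> has_deficient_star V ?G v" if v: "v \<in> V" for v
  proof -
    obtain C where C: "C \<subseteq> V - {v}" "card C = card V - 2"
        "berge_core {A \<in> F. v \<notin> A} C \<or> berge_core {A \<in> ?G. v \<notin> A} C"
      using IH[OF v] by blast
    have finC: "finite C" "v \<notin> C" using C V finite_subset[of C V] by auto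
    have insC: "insert v C \<subseteq> V" "card (insert v C) = card V - 1" using C finC v V by auto
    have star: "has_deficient_star V H v"
      if H: "finite H" "berge_core {A \<in> H. v \<notin> A} C" "\<not> berge_core H (insert v C)" for H
    proof -
      obtain X where X: "X \<subseteq> C" "deficient_star H v X"
        using berge_core_insert[OF finC(1) H(1) finC(2) H(2,3)] by blast
      then have "card X \<le> card V - 2" using card_mono[OF finC(1) X(1)] C by simp
      then show ?thesis using X C unfolding has_deficient_star_def by blast
    qed
    show ?thesis using C(3) star[OF finF _ noF[OF insC]] star[OF _ _ noG[OF insC]] V by auto
  qed
  have del: "V - {v} \<subseteq> V" "card (V - {v}) = card V - 1" if "v \<in> V" for v
    using that V by auto
  have mixed: False
    if vw: "v \<in> V" "w \<in> V" "v \<noteq> w" "has_deficient_star V F v" "has_deficient_star V ?G w" for v w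
  proof -
    obtain X where X: "X \<subseteq> V - {v}" "card X \<le> card V - 2" "deficient_star F v X"
      using vw(4) unfolding has_deficient_star_def by blast
    obtain Y where Y: "Y \<subseteq> V - {w}" "card Y \<le> card V - 2" "deficient_star ?G w Y"
      using vw(5) unfolding has_deficient_star_def by blast
    from deficient_stars_opposite[OF V vw(1-3) F X Y] show False
    proof (elim disjE exE conjE)
      fix x assume x: "X = {x}" "x \<noteq> w" "card Y = card V - 2"
      have "berge_core F (V - {v})"
        using X x Y vw stars
        by (intro berge_core_if_exceptional_stars[OF V _ _ _ _ _ _ F, of v x w Y]) auto
      then show False using noF[OF del[OF vw(1)]] by blast
    next
      fix y assume y: "Y = {y}" "y \<noteq> v" "card X = card V - 2"
      have "berge_core ?G (V - {w})"
        using X y Y vw stars FG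
        by (intro berge_core_if_exceptional_stars[OF V, of w y v ?G X]) auto
      then show False using noG[OF del[OF vw(2)]] by blast
    qed
  qed
  obtain u where u: "u \<in> V" using V by fastforce
  have "\<not> (\<forall>v\<in>V. has_deficient_star V F v)"
    using berge_core_if_all_deficient[OF V F u] noG[OF del[OF u]] by blast
  moreover have "\<not> (\<forall>v\<in>V. has_deficient_star V ?G v)"
    using berge_core_if_all_deficient[OF V _ u, of ?G] noF[OF del[OF u]] FG by auto
  ultimately obtain v w where "v \<in> V" "w \<in> V" "\<not> has_deficient_star V F w" "\<not> has_deficient_star V ?G v"
    by blast
  then show False using mixed[of v w] stars by metis
qed

section \<open>Counting quadruples that contain a given pair\<close>

text \<open>The list \<open>L\<close> matches the pairs outside \<open>B\<close> with distinct quadruples that \<open>B\<close> does not reach, so each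
  further pair of \<open>S\<close> contributes at least one new quadruple.\<close>

lemma card_covering_ge:
  fixes L :: "('a set \<times> 'a set) list"
  assumes V: "finite V" and S: "B \<subseteq> S" "finite S" "S - B \<subseteq> fst ` set L"
    and L: "distinct (map snd L)"
      "\<forall>(p, q)\<in>set L. p \<subseteq> q \<and> q \<in> quads V \<and> (\<forall>b\<in>B. \<not> b \<subseteq> q)"
  shows "card (covering (quads V) B) + card (S - B) \<le> card (covering (quads V) S)"
proof -
  let ?M = "{m \<in> set L. fst m \<in> S}"
  have sub: "snd ` ?M \<subseteq> covering (quads V) S - covering (quads V) B"
  proof
    fix q assume "q \<in> snd ` ?M"
    then obtain p where "(p, q) \<in> set L" "p \<in> S" by auto
    then show "q \<in> covering (quads V) S - covering (quads V) B"
      using bspec[OF L(2), of "(p, q)"] unfolding covering_def by auto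
  qed
  have "card (S - B) \<le> card (fst ` ?M)" using S by (intro card_mono) auto
  also have "\<dots> \<le> card ?M" by (rule card_image_le) simp
  also have "\<dots> = card (snd ` ?M)"
    using L(1) by (intro card_image[symmetric]) (auto simp: distinct_map inj_on_def)
  finally have "card (covering (quads V) B) + card (S - B)
    \<le> card (covering (quads V) B) + card (snd ` ?M)" by simp
  also have "\<dots> = card (covering (quads V) B \<union> snd ` ?M)"
    using V sub by (intro card_Un_disjoint[symmetric]) auto
  also have "\<dots> \<le> card (covering (quads V) S)"
    using V S(1) sub by (intro card_mono) (auto simp: covering_def)
  finally show ?thesis .
qed

lemma card_covering_ge_length:
  assumes "finite V" "distinct Q" "\<forall>A\<in>set Q. A \<in> quads V \<and> (\<exists>p\<in>S. p \<subseteq> A)"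
  shows "length Q \<le> card (covering (quads V) S)"
proof -
  have "card (set Q) \<le> card (covering (quads V) S)"
    using assms by (intro card_mono) (auto simp: covering_def)
  then show ?thesis using assms by (simp add: distinct_card)
qed

lemma pairs_lessThan_4:
  "pairs {..<4::nat} \<subseteq> set [{0,1},{0,2},{0,3},{1,2},{1,3},{2,3}]"
proof
  fix p :: "nat set" assume "p \<in> pairs {..<4}"
  then obtain x y where "p = {x, y}" "x \<in> set [0..<4]" "y \<in> set [0..<4]" "x \<noteq> y"
    by (auto elim: pairsE)
  moreover have "\<forall>x\<in>set [0..<4]. \<forall>y\<in>set [0..<4]. x \<noteq> y \<longrightarrow>
    {x, y} \<in> set [{0,1},{0,2},{0,3},{1,2},{1,3},{2,3}]"
    by code_simp
  ultimately show "p \<in> set [{0,1},{0,2},{0,3},{1,2},{1,3},{2,3}]"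
    by blast
qed

lemma pairs_lessThan_6:
  "pairs {..<6::nat} \<subseteq> set [{0,1},{0,2},{0,3},{0,4},{0,5},{1,2},{1,3},{1,4},
    {1,5},{2,3},{2,4},{2,5},{3,4},{3,5},{4,5}]"
proof
  fix p :: "nat set" assume "p \<in> pairs {..<6}"
  then obtain x y where "p = {x, y}" "x \<in> set [0..<6]" "y \<in> set [0..<6]" "x \<noteq> y"
    by (auto elim: pairsE)
  moreover have "\<forall>x\<in>set [0..<6]. \<forall>y\<in>set [0..<6]. x \<noteq> y \<longrightarrow>
    {x, y} \<in> set [{0,1},{0,2},{0,3},{0,4},{0,5},{1,2},{1,3},{1,4},
    {1,5},{2,3},{2,4},{2,5},{3,4},{3,5},{4,5}]"
    by code_simp
  ultimately show "p \<in> set [{0,1},{0,2},{0,3},{0,4},{0,5},{1,2},{1,3},{1,4},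
    {1,5},{2,3},{2,4},{2,5},{3,4},{3,5},{4,5}]"
    by blast
qed

lemma covering_disjoint_pairs_7:
  assumes S: "S \<subseteq> pairs {..<6::nat}" "{0,1} \<in> S" "{2,3} \<in> S"
  shows "17 + card S \<le> card (covering (quads {..<7}) S)"
proof -
  let ?B = "{{0,1},{2,3}} :: nat set set"
  let ?L = "[({0,2},{0,2,4,6}), ({0,3},{0,3,4,6}), ({1,2},{1,2,4,6}), ({1,3},{1,3,4,6}),
    ({0,4},{0,4,5,6}), ({1,4},{1,4,5,6}), ({2,4},{2,4,5,6}), ({3,4},{3,4,5,6}),
    ({0,5},{0,2,5,6}), ({1,5},{1,3,5,6}), ({2,5},{1,2,5,6}), ({3,5},{0,3,5,6}),
    ({4,5},{0,2,4,5})] :: (nat set \<times> nat set) list"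
  let ?Q = "[{0,1,2,3},{0,1,2,4},{0,1,2,5},{0,1,2,6},{0,1,3,4},{0,1,3,5},{0,1,3,6},{0,1,4,5},
    {0,1,4,6},{0,1,5,6},{2,3,0,4},{2,3,0,5},{2,3,0,6},{2,3,1,4},{2,3,1,5},{2,3,1,6},{2,3,4,5},
    {2,3,4,6},{2,3,5,6}] :: nat set list"
  have "length ?Q \<le> card (covering (quads {..<7}) ?B)"
  proof (rule card_covering_ge_length)
    show "distinct ?Q" by code_simp
    show "\<forall>A\<in>set ?Q. A \<in> quads {..<7} \<and> (\<exists>p\<in>?B. p \<subseteq> A)" by (simp add: quads_def)
  qed simp
  moreover have "card (covering (quads {..<7}) ?B) + card (S - ?B) \<le> card (covering (quads {..<7}) S)"
  proof (rule card_covering_ge)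
    show "S - ?B \<subseteq> fst ` set ?L"
    proof -
      have "set [{0,1},{0,2},{0,3},{0,4},{0,5},{1,2},{1,3},{1,4},
    {1,5},{2,3},{2,4},{2,5},{3,4},{3,5},{4,5}] - ?B
        \<subseteq> fst ` set ?L"
        by code_simp
      then show ?thesis using S(1) pairs_lessThan_6 by blast
    qed
    show "distinct (map snd ?L)" by code_simp
    show "\<forall>(p, q)\<in>set ?L. p \<subseteq> q \<and> q \<in> quads {..<7} \<and> (\<forall>b\<in>?B. \<not> b \<subseteq> q)" by (simp add: quads_def)
  qed (use S finite_subset[OF S(1)] in auto)
  moreover have "card (S - ?B) = card S - 2"
    using S finite_subset[OF S(1)] by (simp add: card_Diff_subset doubleton_eq_iff)
  ultimately show ?thesis by simp
qed


lemma covering_triangle_7: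
  "20 \<le> card (covering (quads {..<7}) {{0,1},{0,2},{1,2::nat}})"
proof -
  let ?Q = "[{0,1,2,3},{0,1,2,4},{0,1,2,5},{0,1,2,6},
    {0,1,3,4},{0,1,3,5},{0,1,3,6},{0,1,4,5},{0,1,4,6},{0,1,5,6},
    {0,2,3,4},{0,2,3,5},{0,2,3,6},{0,2,4,5},{0,2,4,6},{0,2,5,6},
    {1,2,3,4},{1,2,3,5},{1,2,3,6},{1,2,4,5}] :: nat set list"
  have "length ?Q \<le> card (covering (quads {..<7}) {{0,1},{0,2},{1,2::nat}})"
  proof (rule card_covering_ge_length)
    show "distinct ?Q" by code_simp
    show "\<forall>A\<in>set ?Q. A \<in> quads {..<7} \<and> (\<exists>p\<in>{{0,1},{0,2},{1,2}}. p \<subseteq> A)"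
      by (simp add: quads_def)
  qed simp
  then show ?thesis by simp
qed

lemma covering_path_6:
  assumes S: "S \<subseteq> pairs {..<4::nat}" "{0,1} \<in> S" "{0,2} \<in> S"
  shows "7 + card S \<le> card (covering (quads {..<6}) S)"
proof -
  let ?B = "{{0,1},{0,2}} :: nat set set"
  let ?L = "[({0,3},{0,3,4,5}), ({1,2},{1,2,4,5}), ({1,3},{1,3,4,5}), ({2,3},{2,3,4,5})]
    :: (nat set \<times> nat set) list"
  let ?Q = "[{0,1,2,3},{0,1,2,4},{0,1,2,5},{0,1,3,4},{0,1,3,5},{0,1,4,5},{0,2,3,4},{0,2,3,5},{0,2,4,5}]
    :: nat set list"
  have "length ?Q \<le> card (covering (quads {..<6}) ?B)"
  proof (rule card_covering_ge_length)
    show "distinct ?Q" by code_simp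
    show "\<forall>A\<in>set ?Q. A \<in> quads {..<6} \<and> (\<exists>p\<in>?B. p \<subseteq> A)" by (simp add: quads_def)
  qed simp
  moreover have "card (covering (quads {..<6}) ?B) + card (S - ?B) \<le> card (covering (quads {..<6}) S)"
  proof (rule card_covering_ge)
    show "S - ?B \<subseteq> fst ` set ?L"
    proof -
      have "set [{0,1},{0,2},{0,3},{1,2},{1,3},{2,3}] - ?B
        \<subseteq> fst ` set ?L"
        by code_simp
      then show ?thesis using S(1) pairs_lessThan_4 by blast
    qed
    show "distinct (map snd ?L)" by code_simp
    show "\<forall>(p, q)\<in>set ?L. p \<subseteq> q \<and> q \<in> quads {..<6} \<and> (\<forall>b\<in>?B. \<not> b \<subseteq> q)"
      by (simp add: quads_def)
  qed (use S finite_subset[OF S(1)] in auto)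
  moreover have "card (S - ?B) = card S - 2"
    using S finite_subset[OF S(1)] by (simp add: card_Diff_subset doubleton_eq_iff)
  ultimately show ?thesis by simp
qed

lemma covering_disjoint_pairs_6:
  assumes S: "S \<subseteq> pairs {..<4::nat}" "{0,1} \<in> S" "{2,3} \<in> S"
  shows "7 + card S \<le> card (covering (quads {..<6}) S)"
proof -
  let ?B = "{{0,1},{2,3}} :: nat set set"
  let ?L = "[({0,2},{0,2,4,5}), ({0,3},{0,3,4,5}), ({1,2},{1,2,4,5}), ({1,3},{1,3,4,5})]
    :: (nat set \<times> nat set) list"
  let ?Q = "[{0,1,2,3},{0,1,2,4},{0,1,2,5},{0,1,3,4},{0,1,3,5},{0,1,4,5},{0,2,3,4},{0,2,3,5},{1,2,3,4}]
    :: nat set list"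
  have "length ?Q \<le> card (covering (quads {..<6}) ?B)"
  proof (rule card_covering_ge_length)
    show "distinct ?Q" by code_simp
    show "\<forall>A\<in>set ?Q. A \<in> quads {..<6} \<and> (\<exists>p\<in>?B. p \<subseteq> A)" by (simp add: quads_def)
  qed simp
  moreover have "card (covering (quads {..<6}) ?B) + card (S - ?B) \<le> card (covering (quads {..<6}) S)"
  proof (rule card_covering_ge)
    show "S - ?B \<subseteq> fst ` set ?L"
    proof -
      have "set [{0,1},{0,2},{0,3},{1,2},{1,3},{2,3}] - ?B
        \<subseteq> fst ` set ?L"
        by code_simp
      then show ?thesis using S(1) pairs_lessThan_4 by blast
    qed
    show "distinct (map snd ?L)" by code_simp
    show "\<forall>(p, q)\<in>set ?L. p \<subseteq> q \<and> q \<in> quads {..<6} \<and> (\<forall>b\<in>?B. \<not> b \<subseteq> q)"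
      by (simp add: quads_def)
  qed (use S finite_subset[OF S(1)] in auto)
  moreover have "card (S - ?B) = card S - 2"
    using S finite_subset[OF S(1)] by (simp add: card_Diff_subset doubleton_eq_iff)
  ultimately show ?thesis by simp
qed

lemma covering_relabel:
  assumes ys: "distinct ys" "set ys = V" and S: "S \<subseteq> pairs (set (take m ys))" "m \<le> length ys"
  defines "S' \<equiv> {p \<in> pairs {..<m}. (!) ys ` p \<in> S}"
  shows "card S \<le> card S'"
    "card (covering (quads {..<length ys}) S') \<le> card (covering (quads V) S)"
proof -
  let ?f = "(!) ys"
  have bij: "bij_betw ?f {..<length ys} V" using ys by (intro bij_betw_nth) auto
  have inj: "inj_on ?f {..<length ys}" using bij by (rule bij_betw_imp_inj_on)
  have card_im: "card (?f ` A) = card A" if "A \<subseteq> {..<length ys}" for A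
    using inj_on_subset[OF inj that] by (rule card_image)
  have "S \<subseteq> image ?f ` S'"
  proof
    fix p assume p: "p \<in> S"
    then have "p \<in> pairs (set (take m ys))" using S by blast
    then obtain x y where xy: "p = {x, y}" "x \<in> set (take m ys)" "y \<in> set (take m ys)" "x \<noteq> y"
      by (rule pairsE)
    then obtain i j where "i < m" "x = ys ! i" "j < m" "y = ys ! j" "i < length ys" "j < length ys"
      by (auto simp: in_set_conv_nth)
    then have "p = ?f ` {i, j}" "{i, j} \<in> pairs {..<m}" using xy by auto
    then show "p \<in> image ?f ` S'" using p unfolding S'_def by blast
  qed
  moreover have "finite S'" unfolding S'_def by simp
  ultimately show "card S \<le> card S'" by (rule surj_card_le[rotated])
  have "inj_on (image ?f) (covering (quads {..<length ys}) S')"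
    using inj_on_image_Pow[OF inj]
    by (rule inj_on_subset) (auto simp: covering_def quads_def)
  moreover have "image ?f ` covering (quads {..<length ys}) S' \<subseteq> covering (quads V) S"
  proof
    fix B assume "B \<in> image ?f ` covering (quads {..<length ys}) S'"
    then obtain A p where A: "B = ?f ` A" "A \<subseteq> {..<length ys}" "card A = 4" "p \<in> S'" "p \<subseteq> A"
      unfolding covering_def quads_def by auto
    have "B \<subseteq> V" using A(1,2) bij_betw_imp_surj_on[OF bij] by blast
    moreover have "card B = 4" using A card_im by simp
    moreover have "?f ` p \<in> S" "?f ` p \<subseteq> B" using A unfolding S'_def by auto
    ultimately show "B \<in> covering (quads V) S" unfolding covering_def quads_def by blast
  qed
  moreover have "finite (covering (quads V) S)" using ys by auto
  ultimately show "card (covering (quads {..<length ys}) S') \<le> card (covering (quads V) S)"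
    by (rule card_inj_on_le)
qed

section \<open>The majority color on six and seven vertices\<close>

lemma extend_to_enumeration:
  assumes "finite V" "C \<subseteq> V" "distinct xs" "set xs \<subseteq> C"
  obtains ys where "distinct (xs @ ys)" "set (xs @ ys) = V" "set (take (card C) (xs @ ys)) = C"
    "length (xs @ ys) = card V"
proof -
  have "finite C" using assms finite_subset by blast
  then obtain us where us: "set us = C - set xs" "distinct us"
    using finite_distinct_list[of "C - set xs"] by auto
  obtain vs where vs: "set vs = V - C" "distinct vs"
    using finite_distinct_list[of "V - C"] assms by auto
  have C: "set (xs @ us) = C" "distinct (xs @ us)" using us assms by auto
  then have "length (xs @ us) = card C" by (metis distinct_card)
  then have "take (card C) (xs @ us @ vs) = xs @ us" by simp
  moreover have "distinct (xs @ us @ vs)" "set (xs @ us @ vs) = V" using C us vs assms by auto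
  ultimately show thesis using that[of "us @ vs"] C by (metis distinct_card)
qed

lemma covering_disjoint_pairs:
  assumes V: "finite V" "card V = 7" and C: "C \<subseteq> V" "card C = 6"
    and S: "S \<subseteq> pairs C" "p \<in> S" "q \<in> S" "p \<inter> q = {}"
  shows "17 + card S \<le> card (covering (quads V) S)"
proof -
  have pq: "p \<in> pairs C" "q \<in> pairs C" using S by auto
  obtain a b where p: "p = {a, b}" "a \<in> C" "b \<in> C" "a \<noteq> b" using pq(1) by (rule pairsE)
  obtain c d where q: "q = {c, d}" "c \<in> C" "d \<in> C" "c \<noteq> d" using pq(2) by (rule pairsE)
  have "distinct [a, b, c, d]" "set [a, b, c, d] \<subseteq> C" using p q S(4) by auto
  then obtain ys where ys: "distinct ([a, b, c, d] @ ys)" "set ([a, b, c, d] @ ys) = V"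
      "set (take (card C) ([a, b, c, d] @ ys)) = C" "length ([a, b, c, d] @ ys) = card V"
    using extend_to_enumeration[OF V(1) C(1)] by blast
  let ?ys = "[a, b, c, d] @ ys"
  let ?S = "{p \<in> pairs {..<6}. (!) ?ys ` p \<in> S}"
  have "17 + card ?S \<le> card (covering (quads {..<7}) ?S)"
    using S(2,3) p q by (intro covering_disjoint_pairs_7) (auto simp: numeral_eq_Suc)
  moreover have "card S \<le> card ?S" "card (covering (quads {..<length ?ys}) ?S) \<le> card (covering (quads V) S)"
    using covering_relabel[OF ys(1,2), of S 6] S(1) ys(3,4) C V by (simp_all only:)
  ultimately show ?thesis using ys(4) V by simp
qed

lemma covering_triangle:
  assumes V: "finite V" "card V = 7" and abc: "a \<in> V" "b \<in> V" "c \<in> V" "a \<noteq> b" "a \<noteq> c" "b \<noteq> c"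
  shows "20 \<le> card (covering (quads V) {{a, b}, {a, c}, {b, c}})"
proof -
  have "distinct [a, b, c]" "set [a, b, c] \<subseteq> V" using abc by auto
  then obtain ys where ys: "distinct ([a, b, c] @ ys)" "set ([a, b, c] @ ys) = V"
      "set (take (card V) ([a, b, c] @ ys)) = V" "length ([a, b, c] @ ys) = card V"
    using extend_to_enumeration[OF V(1) order.refl] by blast
  let ?ys = "[a, b, c] @ ys"
  let ?T = "{{a, b}, {a, c}, {b, c}}"
  let ?S = "{p \<in> pairs {..<7}. (!) ?ys ` p \<in> ?T}"
  have "{{0,1},{0,2},{1,2}} \<subseteq> ?S" by (auto simp: numeral_eq_Suc)
  from card_mono[OF _ covering_mono[OF this, of "quads {..<7}"]]
  have "20 \<le> card (covering (quads {..<7}) ?S)" using covering_triangle_7 by simp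
  moreover have "card (covering (quads {..<length ?ys}) ?S) \<le> card (covering (quads V) ?T)"
    using covering_relabel(2)[OF ys(1,2), of ?T 7] abc ys(3,4) V by (simp_all only:) auto
  ultimately show ?thesis using ys(4) V by simp
qed

lemma covering_two_pairs:
  assumes V: "finite V" "card V = 6" and C: "C \<subseteq> V" "card C = 4"
    and S: "S \<subseteq> pairs C" "p \<in> S" "q \<in> S" "p \<noteq> q"
  shows "7 + card S \<le> card (covering (quads V) S)"
proof -
  have pq: "p \<in> pairs C" "q \<in> pairs C" using S by auto
  show ?thesis
  proof (cases "p \<inter> q = {}")
    case True
    obtain a b where p: "p = {a, b}" "a \<in> C" "b \<in> C" "a \<noteq> b" using pq(1) by (rule pairsE)
    obtain c d where q: "q = {c, d}" "c \<in> C" "d \<in> C" "c \<noteq> d" using pq(2) by (rule pairsE)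
    have "distinct [a, b, c, d]" "set [a, b, c, d] \<subseteq> C" using p q True by auto
    then obtain ys where ys: "distinct ([a, b, c, d] @ ys)" "set ([a, b, c, d] @ ys) = V"
        "set (take (card C) ([a, b, c, d] @ ys)) = C" "length ([a, b, c, d] @ ys) = card V"
      using extend_to_enumeration[OF V(1) C(1)] by blast
    let ?ys = "[a, b, c, d] @ ys"
    let ?S = "{p \<in> pairs {..<4}. (!) ?ys ` p \<in> S}"
    have "7 + card ?S \<le> card (covering (quads {..<6}) ?S)"
      using S(2,3) p q by (intro covering_disjoint_pairs_6) (auto simp: numeral_eq_Suc)
    moreover have "card S \<le> card ?S"
        "card (covering (quads {..<length ?ys}) ?S) \<le> card (covering (quads V) S)"
      using covering_relabel[OF ys(1,2), of S 4] S(1) ys(3,4) C V by (simp_all only:)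
    ultimately show ?thesis using ys(4) V by simp
  next
    case False
    then obtain a where a: "a \<in> p" "a \<in> q" by blast
    obtain b where p: "p = {a, b}" "b \<in> C" "a \<noteq> b" using pq(1) a(1) by (auto elim!: pairsE)
    obtain c where q: "q = {a, c}" "c \<in> C" "a \<noteq> c" using pq(2) a(2) by (auto elim!: pairsE)
    have "distinct [a, b, c]" "set [a, b, c] \<subseteq> C" using p q S(4) pq by auto
    then obtain ys where ys: "distinct ([a, b, c] @ ys)" "set ([a, b, c] @ ys) = V"
        "set (take (card C) ([a, b, c] @ ys)) = C" "length ([a, b, c] @ ys) = card V"
      using extend_to_enumeration[OF V(1) C(1)] by blast
    let ?ys = "[a, b, c] @ ys"
    let ?S = "{p \<in> pairs {..<4}. (!) ?ys ` p \<in> S}"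
    have "7 + card ?S \<le> card (covering (quads {..<6}) ?S)"
      using S(2,3) p q by (intro covering_path_6) (auto simp: numeral_eq_Suc)
    moreover have "card S \<le> card ?S"
        "card (covering (quads {..<length ?ys}) ?S) \<le> card (covering (quads V) S)"
      using covering_relabel[OF ys(1,2), of S 4] S(1) ys(3,4) C V by (simp_all only:)
    ultimately show ?thesis using ys(4) V by simp
  qed
qed

lemma card_covering_le:
  assumes "finite V" "F \<subseteq> quads V"
  shows "card (covering (quads V) S) \<le> card (covering F S) + (card (quads V) - card F)"
proof -
  have "covering (quads V) S \<subseteq> covering F S \<union> (quads V - F)" unfolding covering_def by auto
  moreover have finF: "finite F" using assms finite_subset by fastforce
  ultimately have "card (covering (quads V) S) \<le> card (covering F S \<union> (quads V - F))"
    using assms by (intro card_mono) auto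
  also have "\<dots> \<le> card (covering F S) + card (quads V - F)" by (rule card_Un_le)
  finally show ?thesis using assms finF by (simp add: card_Diff_subset)
qed

lemma berge_core_6:
  assumes V: "finite V" "card V = 6" and F: "F \<subseteq> quads V" "8 \<le> card F"
  shows "\<exists>C\<subseteq>V. card C = 4 \<and> berge_core F C"
proof (rule ccontr)
  assume no: "\<not> ?thesis"
  have finF: "finite F" using V F finite_subset by fastforce
  have le: "card (covering (quads V) S) \<le> card (covering F S) + 7" for S
    using card_covering_le[OF V(1) F(1), of S] F(2) V by (simp add: card_quads numeral_eq_Suc)
  have missing: "\<exists>p\<in>pairs C. covering F {p} = {}" if C: "C \<subseteq> V" "card C = 4" for C
  proof -
    have "\<not> berge_core F C" using no C by blast
    moreover have finC: "finite C" using V C finite_subset by blast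
    ultimately obtain S where S: "S \<subseteq> pairs C" "card (covering F S) < card S"
      using hall_violator finF by metis
    have "p = q" if "p \<in> S" "q \<in> S" for p q
      using covering_two_pairs[OF V C S(1) that] le[of S] S(2) by linarith
    moreover have "S \<noteq> {}" using S by auto
    ultimately obtain p where "S = {p}" by blast
    then show ?thesis using S finF by auto
  qed
  have "4 \<le> card V" using V by simp
  then obtain C where C: "C \<subseteq> V" "card C = 4" by (rule obtain_subset_with_card_n)
  obtain p where p: "p \<in> pairs V" "covering F {p} = {}"
    using missing[OF C] pairs_mono[OF C(1)] by blast
  obtain a b where ab: "p = {a, b}" "a \<in> V" "b \<in> V" using p(1) by (rule pairsE)
  have "4 \<le> card (V - {a})" using V ab by simp
  then obtain D where D: "D \<subseteq> V - {a}" "card D = 4" by (rule obtain_subset_with_card_n)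
  have "D \<subseteq> V" using D by blast
  then obtain q where q: "q \<in> pairs (V - {a})" "covering F {q} = {}"
    using missing[OF _ D(2)] pairs_mono[OF D(1)] by blast
  have "p \<noteq> q" using q ab unfolding pairs_def by auto
  have "card (p \<union> q) \<le> 4" using card_Un_le[of p q] p q unfolding pairs_def by simp
  moreover have "p \<union> q \<subseteq> V" using p q unfolding pairs_def by auto
  ultimately obtain E where E: "p \<union> q \<subseteq> E" "E \<subseteq> V" "card E = 4"
    using exists_subset_between[of "p \<union> q" 4 V] V by auto
  have "{p, q} \<subseteq> pairs E" using p q E unfolding pairs_def by auto
  then have "7 + card {p, q} \<le> card (covering (quads V) {p, q})"
    using \<open>p \<noteq> q\<close> by (intro covering_two_pairs[OF V E(2,3)]) auto
  moreover have "covering F {p, q} = {}" using p q unfolding covering_def by auto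
  ultimately show False using le[of "{p, q}"] \<open>p \<noteq> q\<close> by simp
qed

lemma intersecting_pairs:
  assumes S: "S \<subseteq> pairs C" "S \<noteq> {}" and int: "\<And>p q. p \<in> S \<Longrightarrow> q \<in> S \<Longrightarrow> p \<inter> q \<noteq> {}"
  obtains b where "b \<in> C" "\<And>p. p \<in> S \<Longrightarrow> b \<in> p"
  | a b c where "a \<in> C" "b \<in> C" "c \<in> C" "a \<noteq> b" "a \<noteq> c" "b \<noteq> c" "S = {{a, b}, {a, c}, {b, c}}"
proof -
  have inC: "\<exists>x y. p = {x, y} \<and> x \<in> C \<and> y \<in> C \<and> x \<noteq> y" if "p \<in> S" for p
  proof -
    have "p \<in> pairs C" using that S by blast
    then show ?thesis by (rule pairsE) blast
  qed
  obtain a b where ab: "{a, b} \<in> S" "a \<in> C" "b \<in> C" "a \<noteq> b" using S(2) inC by (metis ex_in_conv)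
  show thesis
  proof (cases "(\<forall>p\<in>S. a \<in> p) \<or> (\<forall>p\<in>S. b \<in> p)")
    case True
    then show ?thesis using that(1) ab by blast
  next
    case False
    then obtain q r where q: "q \<in> S" "a \<notin> q" and r: "r \<in> S" "b \<notin> r" by blast
    have "b \<in> q" using int[OF q(1) ab(1)] q by auto
    then obtain c where c: "q = {b, c}" "c \<in> C" "b \<noteq> c" using inC[OF q(1)] by auto
    have "a \<in> r" using int[OF r(1) ab(1)] r by auto
    moreover have "c \<in> r" using int[OF r(1) q(1)] r c by auto
    moreover have "a \<noteq> c" using q c by auto
    ultimately have rc: "r = {a, c}" using inC[OF r(1)] by auto
    have "p \<in> {{a, b}, {a, c}, {b, c}}" if p: "p \<in> S" for p
    proof -
      obtain x y where "p = {x, y}" using inC[OF p] by auto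
      then show ?thesis
        using int[OF p ab(1)] int[OF p q(1)] int[OF p r(1)] c rc ab \<open>a \<noteq> c\<close> by auto
    qed
    then have "S = {{a, b}, {a, c}, {b, c}}" using ab q r c rc by auto
    then show ?thesis using that(2)[of a b c] ab c \<open>a \<noteq> c\<close> by auto
  qed
qed

lemma card_quads_star:
  assumes W: "finite W" "b \<notin> W" "X \<subseteq> W"
  shows "card {A \<in> quads (insert b W). b \<in> A \<and> A \<inter> X \<noteq> {}} =
    (card W choose 3) - ((card W - card X) choose 3)"
proof -
  let ?T = "\<lambda>W. {T. T \<subseteq> W \<and> card T = 3}"
  have eq: "{A \<in> quads (insert b W). b \<in> A \<and> A \<inter> X \<noteq> {}} = insert b ` (?T W - ?T (W - X))"
  proof (intro equalityI subsetI)
    fix A assume A: "A \<in> {A \<in> quads (insert b W). b \<in> A \<and> A \<inter> X \<noteq> {}}"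
    then have "A = insert b (A - {b})" "A - {b} \<subseteq> W" "card (A - {b}) = 3" "\<not> A - {b} \<subseteq> W - X"
      using W unfolding quads_def by (auto simp: card_Diff_singleton)
    then show "A \<in> insert b ` (?T W - ?T (W - X))" by blast
  next
    fix A assume "A \<in> insert b ` (?T W - ?T (W - X))"
    then obtain T where T: "A = insert b T" "T \<subseteq> W" "card T = 3" "\<not> T \<subseteq> W - X" by auto
    have "b \<notin> T" "finite T" using T W finite_subset by auto
    then show "A \<in> {A \<in> quads (insert b W). b \<in> A \<and> A \<inter> X \<noteq> {}}"
      using T unfolding quads_def by auto
  qed
  have "inj_on (insert b) (?T W - ?T (W - X))"
  proof (rule inj_onI)
    fix S T assume "S \<in> ?T W - ?T (W - X)" "T \<in> ?T W - ?T (W - X)" "insert b S = insert b T"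
    moreover from this have "b \<notin> S" "b \<notin> T" using W(2) by auto
    ultimately show "S = T" by (simp add: insert_ident)
  qed
  then have "card {A \<in> quads (insert b W). b \<in> A \<and> A \<inter> X \<noteq> {}} = card (?T W - ?T (W - X))"
    unfolding eq by (rule card_image)
  also have "\<dots> = card (?T W) - card (?T (W - X))"
    using W by (intro card_Diff_subset) auto
  also have "\<dots> = (card W choose 3) - (card (W - X) choose 3)"
    using W by (simp add: n_subsets)
  also have "card (W - X) = card W - card X" using W finite_subset by (intro card_Diff_subset) auto
  finally show ?thesis .
qed

lemma berge_core_7:
  assumes V: "finite V" "card V = 7" and F: "F \<subseteq> quads V" "18 \<le> card F"
  shows "\<exists>C\<subseteq>V. card C = 6 \<and> berge_core F C"
proof (rule ccontr)
  assume no: "\<not> ?thesis"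
  have finF: "finite F" using V F finite_subset by fastforce
  have le: "card (covering (quads V) S) \<le> card (covering F S) + 17" for S
    using card_covering_le[OF V(1) F(1), of S] F(2) V by (simp add: card_quads numeral_eq_Suc)
  have star: "\<exists>b X. b \<in> V \<and> b \<noteq> a \<and> X \<subseteq> V - {a, b} \<and> deficient_star F b X" if a: "a \<in> V" for a
  proof -
    have C: "V - {a} \<subseteq> V" "card (V - {a}) = 6" using V a by auto
    then have "\<not> berge_core F (V - {a})" using no by blast
    then obtain S where S: "S \<subseteq> pairs (V - {a})" "card (covering F S) < card S"
      using hall_violator[of "V - {a}"] finF V by (metis finite_Diff)
    have "S \<noteq> {}" using S by auto
    moreover have "p \<inter> q \<noteq> {}" if "p \<in> S" "q \<in> S" for p q
      using covering_disjoint_pairs[OF V C S(1) that] le[of S] S(2) by linarith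
    ultimately show ?thesis
    proof (rule intersecting_pairs[OF S(1)])
      fix b assume b: "b \<in> V - {a}" "\<And>p. p \<in> S \<Longrightarrow> b \<in> p"
      define X where "X = {x. x \<noteq> b \<and> {b, x} \<in> S}"
      have "S = (\<lambda>x. {b, x}) ` X"
      proof (intro equalityI subsetI)
        fix p assume p: "p \<in> S"
        then have "p \<in> pairs (V - {a})" using S by blast
        then obtain x y where "p = {x, y}" "x \<noteq> y" by (rule pairsE)
        then obtain z where "p = {b, z}" "z \<noteq> b" using b(2)[OF p] by auto
        then show "p \<in> (\<lambda>x. {b, x}) ` X" using p unfolding X_def by blast
      qed (auto simp: X_def)
      moreover have "inj_on (\<lambda>x. {b, x}) X" unfolding X_def by (auto simp: inj_on_def doubleton_eq_iff)
      ultimately have cX: "card S = card X" "covering F S = {A \<in> F. b \<in> A \<and> A \<inter> X \<noteq> {}}"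
        by (auto simp: card_image covering_def)
      moreover have "X \<subseteq> V - {a, b}" using S(1) b unfolding X_def by auto
      ultimately show ?thesis using b S(2) unfolding deficient_star_def by auto
    next
      fix x y z assume xyz: "x \<in> V - {a}" "y \<in> V - {a}" "z \<in> V - {a}" "x \<noteq> y" "x \<noteq> z" "y \<noteq> z"
        "S = {{x, y}, {x, z}, {y, z}}"
      have "20 \<le> card (covering (quads V) S)"
        using covering_triangle[OF V, of x y z] xyz by auto
      moreover have "card S \<le> 3" using xyz by (simp add: card_insert_if)
      ultimately show ?thesis using le[of S] S(2) by linarith
    qed
  qed
  have single: "\<exists>p\<in>pairs (V - {a}). covering F {p} = {}" if a: "a \<in> V" for a
  proof -
    obtain b X where b: "b \<in> V" "b \<noteq> a" "X \<subseteq> V - {a, b}" "deficient_star F b X"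
      using star[OF a] by blast
    obtain c Y where c: "c \<in> V" "c \<noteq> b" "Y \<subseteq> V - {b, c}" "deficient_star F c Y"
      using star[OF b(1)] by blast
    have finX: "finite X" "finite Y" using b c V finite_subset by blast+
    have ne: "card X \<ge> 1" "card Y \<ge> 1" using b(4) c(4) unfolding deficient_star_def by auto
    have W: "card (V - {b}) = 6" "card (V - {b, c}) = 5" "card (V - {a, b}) = 5"
      using V a b c by (auto simp: card_Diff_subset)
    have k: "card X \<le> 5" "card Y \<le> 5"
      using card_mono[OF _ b(3)] card_mono[OF _ c(3)] V W by auto
    let ?E = "{A \<in> quads V. b \<in> A \<and> A \<inter> X \<noteq> {}}"
    let ?D = "{A \<in> quads (V - {b}). c \<in> A \<and> A \<inter> Y \<noteq> {}}"
    have "insert b (V - {b}) = V" "insert c (V - {b, c}) = V - {b}" using b c by auto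
    then have cards: "card ?E = (6 choose 3) - ((6 - card X) choose 3)"
        "card ?D = (5 choose 3) - ((5 - card Y) choose 3)"
      using card_quads_star[of "V - {b}" b X] card_quads_star[of "V - {b, c}" c Y] V b c W by auto
    have "card X = 1"
    proof (rule ccontr)
      assume "card X \<noteq> 1"
      then have "card X \<in> {2, 3, 4, 5}" "card Y \<in> {1, 2, 3, 4, 5}" using ne k by auto
      then have "14 + card X \<le> card ?E" "5 + card Y \<le> card ?D"
        unfolding cards by (auto simp: numeral_eq_Suc)
      moreover have "card (?E \<union> ?D) = card ?E + card ?D"
        using V by (intro card_Un_disjoint) (auto simp: quads_def)
      moreover have "card (?E \<union> ?D) \<le> card X + card Y + 15"
      proof -
        have "?E \<union> ?D \<subseteq> {A \<in> F. b \<in> A \<and> A \<inter> X \<noteq> {}} \<union> {A \<in> F. c \<in> A \<and> A \<inter> Y \<noteq> {}} \<union> (quads V - F)"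
          unfolding quads_def by auto
        then have "card (?E \<union> ?D) \<le> card ({A \<in> F. b \<in> A \<and> A \<inter> X \<noteq> {}} \<union>
            {A \<in> F. c \<in> A \<and> A \<inter> Y \<noteq> {}} \<union> (quads V - F))"
          using V finF by (intro card_mono) auto
        also have "\<dots> \<le> card {A \<in> F. b \<in> A \<and> A \<inter> X \<noteq> {}} + card {A \<in> F. c \<in> A \<and> A \<inter> Y \<noteq> {}} +
            card (quads V - F)"
          by (meson add_le_mono1 card_Un_le order_trans)
        moreover have "card (quads V - F) \<le> 17"
          using V F finF by (simp add: card_Diff_subset card_quads numeral_eq_Suc)
        ultimately show ?thesis using b(4) c(4) unfolding deficient_star_def by linarith
      qed
      ultimately show False by linarith
    qed
    then obtain x where x: "X = {x}" by (auto simp: card_1_singleton_iff)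
    then have "covering F {{b, x}} = {}"
      using b(4) deficient_star_singleton[OF finF] unfolding covering_def by auto
    moreover have "{b, x} \<in> pairs (V - {a})" using b x by auto
    ultimately show ?thesis by blast
  qed
  have meet: "p \<inter> q \<noteq> {}"
    if p: "p \<in> pairs V" "covering F {p} = {}" and q: "q \<in> pairs V" "covering F {q} = {}" for p q
  proof
    assume disj: "p \<inter> q = {}"
    have "card (p \<union> q) \<le> 6" using card_Un_le[of p q] p q unfolding pairs_def by simp
    moreover have "p \<union> q \<subseteq> V" using p q unfolding pairs_def by auto
    ultimately obtain C where C: "p \<union> q \<subseteq> C" "C \<subseteq> V" "card C = 6"
      using exists_subset_between[of "p \<union> q" 6 V] V by auto
    have "{p, q} \<subseteq> pairs C" using p q C unfolding pairs_def by auto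
    then have "17 + card {p, q} \<le> card (covering (quads V) {p, q})"
      using disj by (intro covering_disjoint_pairs[OF V C(2,3)]) auto
    moreover have "covering F {p, q} = {}" using p q unfolding covering_def by auto
    moreover have "p \<noteq> q" using disj p unfolding pairs_def by auto
    ultimately show False using le[of "{p, q}"] by simp
  qed
  have sub: "pairs (V - {a}) \<subseteq> pairs V" for a by (rule pairs_mono) blast
  obtain v where "v \<in> V" using V by fastforce
  then obtain p where p: "p \<in> pairs V" "covering F {p} = {}" using single[of v] sub by blast
  then obtain b x where bx: "p = {b, x}" "b \<in> V" "x \<in> V" "b \<noteq> x" by (auto elim: pairsE)
  obtain q where q: "q \<in> pairs (V - {b})" "covering F {q} = {}" using single bx by blast
  have "x \<in> q" using meet[OF p subsetD[OF sub q(1)] q(2)] bx q(1) unfolding pairs_def by auto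
  then obtain y where y: "q = {x, y}" "y \<in> V" "y \<noteq> b" "y \<noteq> x" using q(1) by (auto elim!: pairsE)
  obtain r where r: "r \<in> pairs (V - {x})" "covering F {r} = {}" using single bx by blast
  have "b \<in> r" using meet[OF p subsetD[OF sub r(1)] r(2)] bx r(1) unfolding pairs_def by auto
  moreover have "y \<in> r"
    using meet[OF subsetD[OF sub q(1)] q(2) subsetD[OF sub r(1)] r(2)] y r(1) unfolding pairs_def by auto
  ultimately have "r = {b, y}" using y(3) r(1) by (auto elim!: pairsE)
  then have "covering F {{b, x}, {b, y}, {x, y}} = {}"
    using p q r bx y unfolding covering_def by auto
  moreover have "20 \<le> card (covering (quads V) {{b, x}, {b, y}, {x, y}})"
    using covering_triangle[OF V] bx y by auto
  ultimately show False using le[of "{{b, x}, {b, y}, {x, y}}"] by simp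
qed

section \<open>Ramsey numbers\<close>

lemma berge_core_5:
  assumes V: "finite V" "card V = 5" and F: "F \<subseteq> quads V" "3 \<le> card F"
  shows "\<exists>C\<subseteq>V. card C = 3 \<and> berge_core F C"
proof -
  have co: "\<exists>x\<in>V. A = V - {x}" if "A \<in> quads V" for A
  proof -
    have A: "A \<subseteq> V" "card A = 4" using that unfolding quads_def by auto
    then have "card (V - A) = 1" using V finite_subset by (subst card_Diff_subset) auto
    then obtain x where "V - A = {x}" by (auto simp: card_1_singleton_iff)
    then show ?thesis using A by blast
  qed
  obtain T where "T \<subseteq> F" "card T = 3" using F(2) by (rule obtain_subset_with_card_n)
  then obtain A B D where ABD: "A \<in> F" "B \<in> F" "D \<in> F" "A \<noteq> B" "A \<noteq> D" "B \<noteq> D"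
    by (auto simp: card_3_iff)
  obtain a where a: "a \<in> V" "A = V - {a}" using co ABD F by blast
  obtain b where b: "b \<in> V" "B = V - {b}" using co ABD F by blast
  obtain d where d: "d \<in> V" "D = V - {d}" using co ABD F by blast
  have ne: "a \<noteq> b" "a \<noteq> d" "b \<noteq> d" using ABD a b d by auto
  let ?C = "{a, b, d}"
  let ?\<psi> = "\<lambda>p. (V - ?C) \<union> p"
  have "inj_on ?\<psi> (pairs ?C)" unfolding inj_on_def pairs_def by blast
  moreover have "?\<psi> p \<in> F \<and> p \<subseteq> ?\<psi> p" if "p \<in> pairs ?C" for p
  proof -
    have "p = {a, b} \<or> p = {a, d} \<or> p = {b, d}" using that by (auto elim!: pairsE)
    moreover have "?\<psi> {a, b} = D" "?\<psi> {a, d} = B" "?\<psi> {b, d} = A" using a b d ne by auto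
    ultimately have "?\<psi> p \<in> {A, B, D}" by (elim disjE) (simp_all only: insert_iff simp_thms)
    then show ?thesis using ABD by blast
  qed
  ultimately have "berge_core F ?C" unfolding berge_core_def by blast
  moreover have "?C \<subseteq> V" "card ?C = 3" using a b d ne by auto
  ultimately show ?thesis by blast
qed

lemma berge_core_pair:
  assumes "V \<in> F" "C \<subseteq> V" "card C = 2"
  shows "berge_core F C"
proof -
  have "finite C" using assms by (metis card.infinite zero_neq_numeral)
  then have "p = C" if "p \<in> pairs C" for p
    using that assms(3) card_subset_eq[of C p] unfolding pairs_def by simp
  then have "inj_on (\<lambda>_. V) (pairs C)" unfolding inj_on_def by metis
  moreover have "\<forall>p\<in>pairs C. V \<in> F \<and> p \<subseteq> V" using assms unfolding pairs_def by blast
  ultimately show ?thesis unfolding berge_core_def by blast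
qed

lemma majority:
  assumes "finite V" "F \<subseteq> quads V" "2 * k \<le> Suc (card (quads V))"
  shows "k \<le> card F \<or> k \<le> card (quads V - F)"
proof -
  have "finite F" using assms finite_subset by fastforce
  then have "card (quads V - F) = card (quads V) - card F" using assms by (intro card_Diff_subset)
  then show ?thesis using assms by linarith
qed

lemma berge_core_monochromatic:
  assumes "6 \<le> t" "finite V" "card V = t + 1" "F \<subseteq> quads V"
  shows "\<exists>C\<subseteq>V. card C = t \<and> (berge_core F C \<or> berge_core (quads V - F) C)"
  using assms
proof (induction t arbitrary: V F rule: nat_induct_at_least)
  case base
  then have "18 \<le> card F \<or> 18 \<le> card (quads V - F)"
    by (intro majority) (auto simp: card_quads numeral_eq_Suc)
  then show ?case
    using berge_core_7[of V F] berge_core_7[of V "quads V - F"] base by auto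
next
  case (Suc t)
  have "\<exists>C\<subseteq>V - {v}. card C = card V - 2 \<and>
      (berge_core {A \<in> F. v \<notin> A} C \<or> berge_core {A \<in> quads V - F. v \<notin> A} C)" if v: "v \<in> V" for v
  proof -
    have "quads (V - {v}) - {A \<in> F. v \<notin> A} = {A \<in> quads V - F. v \<notin> A}"
      unfolding quads_def by auto
    moreover have "{A \<in> F. v \<notin> A} \<subseteq> quads (V - {v})" using Suc.prems unfolding quads_def by auto
    ultimately show ?thesis using Suc.IH[of "V - {v}" "{A \<in> F. v \<notin> A}"] Suc.prems v by auto
  qed
  then show ?case using berge_core_step[of V F] Suc by auto
qed

lemma has_colored_copy_iff:
  "has_colored_copy 4 N c b (BK 4 t) \<longleftrightarrow>
     (\<exists>C\<subseteq>{..<N}. card C = t \<and> berge_core {A \<in> quads {..<N}. c A = b} C)" (is "?L \<longleftrightarrow> ?R")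
proof
  assume ?L
  then obtain H' H where H': "subhypergraph H' (complete_hypergraph 4 N)" "\<forall>e\<in>edges H'. c e = b"
    and H: "H \<in> BK 4 t" and iso: "hypergraph_iso H' H"
    unfolding has_colored_copy_def by blast
  have vH': "verts H' \<subseteq> {..<N}" "edges H' \<subseteq> quads {..<N}" "\<And>e. e \<in> edges H' \<Longrightarrow> e \<subseteq> verts H'"
    using H'(1) unfolding subhypergraph_def complete_hypergraph_def quads_def by auto
  obtain f where f: "bij_betw f (verts H') (verts H)" "edges H = image f ` edges H'"
    using iso unfolding hypergraph_iso_def by auto
  obtain \<phi> \<psi> where \<phi>: "inj_on \<phi> {..<t}" "\<phi> ` {..<t} \<subseteq> verts H"
    and \<psi>: "bij_betw \<psi> (pairs {..<t}) (edges H)"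
    and sub: "\<And>u v. {u, v} \<in> pairs {..<t} \<Longrightarrow> {\<phi> u, \<phi> v} \<subseteq> \<psi> {u, v}"
    using H unfolding berge_def complete_hypergraph_def pairs_def by auto
  define g where "g = inv_into (verts H') f"
  have gf: "g (f x) = x" if "x \<in> verts H'" for x
    using that f(1) unfolding g_def bij_betw_def by simp
  have g: "inj_on g (verts H)" "g ` verts H = verts H'"
    using bij_betw_inv_into[OF f(1)] unfolding g_def bij_betw_def by auto
  define h where "h = g \<circ> \<phi>"
  have h: "inj_on h {..<t}" unfolding h_def using \<phi> g by (auto intro: comp_inj_on inj_on_subset)
  define C where "C = h ` {..<t}"
  define k where "k = inv_into {..<t} h"
  have kh: "k (h i) = i" if "i < t" for i using that h unfolding k_def by simp
  have hk: "h (k x) = x" "k x < t" if "x \<in> C" for x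
    using that f_inv_into_f[of x h "{..<t}"] inv_into_into[of x h "{..<t}"]
    unfolding C_def k_def by auto
  have kp: "k ` p \<in> pairs {..<t}" if p: "p \<in> pairs C" for p
  proof -
    obtain x y where "p = {x, y}" "x \<in> C" "y \<in> C" "x \<noteq> y" using p by (rule pairsE)
    then show ?thesis using hk by (auto dest: arg_cong[where f = h])
  qed
  have gE: "g ` e \<in> edges H' \<and> f ` g ` e = e" if e: "e \<in> edges H" for e
  proof -
    obtain e' where e': "e' \<in> edges H'" "e = f ` e'" using e f(2) by auto
    have "g ` f ` e' = (\<lambda>x. x) ` e'"
      unfolding image_image using gf vH'(3)[OF e'(1)] by (intro image_cong) auto
    then have "g ` e = e'" using e'(2) by simp
    then show ?thesis using e' by simp
  qed
  have inE: "\<psi> (k ` p) \<in> edges H" if "p \<in> pairs C" for p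
    using kp[OF that] \<psi> by (rule bij_betw_apply[rotated])
  let ?\<chi> = "\<lambda>p. g ` \<psi> (k ` p)"
  have "inj_on ?\<chi> (pairs C)"
  proof (rule inj_onI)
    fix p q assume p: "p \<in> pairs C" and q: "q \<in> pairs C" and eq: "?\<chi> p = ?\<chi> q"
    have "\<psi> (k ` p) = \<psi> (k ` q)" using gE[OF inE[OF p]] gE[OF inE[OF q]] eq by metis
    then have "k ` p = k ` q" using kp[OF p] kp[OF q] \<psi> by (metis bij_betw_inv_into_left)
    then have "h ` k ` p = h ` k ` q" by simp
    moreover have "h ` k ` r = r" if "r \<in> pairs C" for r
      using that hk unfolding pairs_def by (force simp: image_image)
    ultimately show "p = q" using p q by metis
  qed
  moreover have "?\<chi> p \<in> {A \<in> quads {..<N}. c A = b} \<and> p \<subseteq> ?\<chi> p" if p: "p \<in> pairs C" for p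
  proof -
    obtain x y where xy: "p = {x, y}" "x \<in> C" "y \<in> C" using p by (rule pairsE)
    have "{\<phi> (k x), \<phi> (k y)} \<subseteq> \<psi> (k ` p)" using sub[of "k x" "k y"] kp[OF p] xy by simp
    then have "g ` {\<phi> (k x), \<phi> (k y)} \<subseteq> ?\<chi> p" by (rule image_mono)
    moreover have "g ` {\<phi> (k x), \<phi> (k y)} = p" using hk xy unfolding h_def by simp
    ultimately have "p \<subseteq> ?\<chi> p" by (simp only:)
    then show ?thesis using gE[OF inE[OF p]] vH'(2) H'(2) by blast
  qed
  ultimately have "berge_core {A \<in> quads {..<N}. c A = b} C" unfolding berge_core_def by blast
  moreover have "card C = t" unfolding C_def using card_image[OF h] by simp
  moreover have "C \<subseteq> {..<N}" using \<phi>(2) g(2) vH'(1) unfolding C_def h_def by force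
  ultimately show ?R by blast
next
  assume ?R
  then obtain C \<psi> where C: "C \<subseteq> {..<N}" "card C = t" and \<psi>: "inj_on \<psi> (pairs C)"
    "\<And>p. p \<in> pairs C \<Longrightarrow> \<psi> p \<in> quads {..<N} \<and> c (\<psi> p) = b \<and> p \<subseteq> \<psi> p"
    unfolding berge_core_def by auto
  have "finite C" using C finite_subset by blast
  then obtain h where h: "bij_betw h {..<t} C"
    using C ex_bij_betw_nat_finite[of C] by (auto simp: atLeast0LessThan)
  define H where "H = \<lparr>verts = {..<N}, edges = \<psi> ` pairs C\<rparr>"
  have im: "bij_betw (image h) (pairs {..<t}) (pairs C)"
  proof (rule bij_betw_imageI)
    show "inj_on (image h) (pairs {..<t})"
      using inj_on_image_Pow[OF bij_betw_imp_inj_on[OF h]]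
      by (rule inj_on_subset) (auto simp: pairs_def)
    have hC: "h ` {..<t} = C" using h by (rule bij_betw_imp_surj_on)
    show "image h ` pairs {..<t} = pairs C"
    proof (intro equalityI subsetI)
      fix p assume "p \<in> image h ` pairs {..<t}"
      then obtain q where q: "q \<in> pairs {..<t}" "p = h ` q" by blast
      obtain i j where "q = {i, j}" "i \<in> {..<t}" "j \<in> {..<t}" "i \<noteq> j" using q(1) by (rule pairsE)
      then show "p \<in> pairs C"
        using q(2) hC inj_onD[OF bij_betw_imp_inj_on[OF h], of i j] by auto
    next
      fix p assume "p \<in> pairs C"
      then obtain x y where p: "p = {x, y}" "x \<in> C" "y \<in> C" "x \<noteq> y" by (rule pairsE)
      then obtain i j where "i < t" "j < t" "x = h i" "y = h j" using hC by blast
      then have "p = h ` {i, j}" "{i, j} \<in> pairs {..<t}" using p by auto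
      then show "p \<in> image h ` pairs {..<t}" by blast
    qed
  qed
  have bij: "bij_betw (\<lambda>p. \<psi> (h ` p)) (pairs {..<t}) (edges H)"
    using bij_betw_trans[OF im inj_on_imp_bij_betw[OF \<psi>(1)]] unfolding H_def by (simp add: comp_def)
  have cover: "{h u, h v} \<subseteq> \<psi> (h ` {u, v})" if "{u, v} \<in> pairs {..<t}" for u v
    using \<psi>(2)[OF bij_betw_apply[OF im that]] by simp
  have "uniform_hypergraph 4 H"
    using \<psi>(2) unfolding uniform_hypergraph_def H_def quads_def by auto
  moreover have "edges (complete_graph t) = pairs {..<t}" "verts (complete_graph t) = {..<t}"
    unfolding complete_hypergraph_def pairs_def by simp_all
  moreover have "inj_on h {..<t}" "h ` {..<t} \<subseteq> verts H"
    using h C unfolding bij_betw_def H_def by auto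
  ultimately have "H \<in> BK 4 t"
    using bij cover unfolding berge_def by (auto intro!: exI[of _ h] exI[of _ "\<lambda>p. \<psi> (h ` p)"])
  moreover have "subhypergraph H (complete_hypergraph 4 N)"
    using \<psi>(2) unfolding subhypergraph_def complete_hypergraph_def H_def quads_def by auto
  moreover have "\<forall>e\<in>edges H. c e = b" using \<psi>(2) unfolding H_def by auto
  moreover have "hypergraph_iso H H" unfolding hypergraph_iso_def by (auto intro!: exI[of _ id])
  ultimately show ?L unfolding has_colored_copy_def by blast
qed

lemma has_colored_copy_mono:
  assumes "has_colored_copy 4 M c b (BK 4 t)" "M \<le> N"
  shows "has_colored_copy 4 N c b (BK 4 t)"
proof -
  obtain C where C: "C \<subseteq> {..<M}" "card C = t" "berge_core {A \<in> quads {..<M}. c A = b} C"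
    using assms(1) unfolding has_colored_copy_iff by blast
  have "{A \<in> quads {..<M}. c A = b} \<subseteq> {A \<in> quads {..<N}. c A = b}"
    using assms(2) unfolding quads_def by force
  then have "berge_core {A \<in> quads {..<N}. c A = b} C" by (rule berge_core_mono[OF C(3)])
  moreover have "C \<subseteq> {..<N}" using C(1) assms(2) by force
  ultimately show ?thesis using C(2) unfolding has_colored_copy_iff by blast
qed

lemma ramsey_number_eqI:
  assumes upper: "\<And>F. F \<subseteq> quads {..<Suc n} \<Longrightarrow>
      \<exists>C\<subseteq>{..<Suc n}. card C = t \<and> (berge_core F C \<or> berge_core (quads {..<Suc n} - F) C)"
    and lower: "\<And>b. \<not> has_colored_copy 4 n c b (BK 4 t)"
  shows "ramsey_number 4 (BK 4 t) (BK 4 t) = enat (Suc n)"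
proof -
  let ?R = "\<lambda>N. \<forall>c. has_colored_copy 4 N c True (BK 4 t) \<or> has_colored_copy 4 N c False (BK 4 t)"
  have "?R (Suc n)"
  proof
    fix c :: "nat set \<Rightarrow> bool"
    let ?V = "{..<Suc n}"
    have "quads ?V - {A \<in> quads ?V. c A = True} = {A \<in> quads ?V. c A = False}" by auto
    then show "has_colored_copy 4 (Suc n) c True (BK 4 t) \<or> has_colored_copy 4 (Suc n) c False (BK 4 t)"
      using upper[of "{A \<in> quads ?V. c A = True}"] unfolding has_colored_copy_iff by auto
  qed
  moreover have "enat (Suc n) \<le> enat N" if "?R N" for N
  proof (rule ccontr)
    assume "\<not> enat (Suc n) \<le> enat N"
    then have "N \<le> n" by simp
    then show False using that lower has_colored_copy_mono by blast
  qed
  ultimately show ?thesis unfolding ramsey_number_def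
    by (intro antisym Inf_lower Inf_greatest) auto
qed

lemma card_quads_containing_pair:
  assumes V: "finite V" "p \<in> pairs V"
  shows "card {A \<in> quads V. p \<subseteq> A} = (card V - 2) choose 2"
proof -
  have p: "p \<subseteq> V" "card p = 2" "finite p" using V finite_subset unfolding pairs_def by auto
  have "bij_betw (\<lambda>A. A - p) {A \<in> quads V. p \<subseteq> A} (pairs (V - p))"
  proof (rule bij_betw_byWitness[where f' = "\<lambda>q. q \<union> p"])
    show "(\<lambda>q. q \<union> p) ` pairs (V - p) \<subseteq> {A \<in> quads V. p \<subseteq> A}"
    proof
      fix A assume "A \<in> (\<lambda>q. q \<union> p) ` pairs (V - p)"
      then obtain q where q: "A = q \<union> p" "q \<subseteq> V - p" "card q = 2" unfolding pairs_def by auto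
      have "finite q" using q(2) V(1) finite_subset by blast
      moreover have "q \<inter> p = {}" using q(2) by blast
      ultimately have "card A = 4" using p q by (simp add: card_Un_disjoint)
      then show "A \<in> {A \<in> quads V. p \<subseteq> A}" using q p unfolding quads_def by auto
    qed
  qed (use p in \<open>auto simp: quads_def pairs_def card_Diff_subset\<close>)
  then have "card {A \<in> quads V. p \<subseteq> A} = card (pairs (V - p))" by (rule bij_betw_same_card)
  then show ?thesis using V p by (simp add: card_pairs card_Diff_subset)
qed

lemma berge_core_card:
  assumes "finite F" "finite C" "berge_core F C"
  shows "card C choose 2 \<le> card F"
proof -
  obtain \<psi> where "inj_on \<psi> (pairs C)" "\<psi> ` pairs C \<subseteq> F"
    using assms(3) unfolding berge_core_def by blast
  then have "card (pairs C) \<le> card F" using assms(1) by (rule card_inj_on_le)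
  then show ?thesis using assms(2) by (simp add: card_pairs)
qed

definition contains_01 :: "nat set \<Rightarrow> bool" where
  "contains_01 A \<longleftrightarrow> {0, 1} \<subseteq> A"

lemma choose_two_Suc: "Suc n choose 2 = n + (n choose 2)"
  by (simp add: numeral_2_eq_2)

lemma no_copy_containing:
  assumes "2 \<le> t" "n \<le> Suc t"
  shows "\<not> has_colored_copy 4 n contains_01 True (BK 4 t)"
proof
  assume "has_colored_copy 4 n contains_01 True (BK 4 t)"
  then have "has_colored_copy 4 (Suc t) contains_01 True (BK 4 t)"
    using assms(2) by (rule has_colored_copy_mono)
  then obtain C where C: "C \<subseteq> {..<Suc t}" "card C = t"
      "berge_core {A \<in> quads {..<Suc t}. contains_01 A = True} C"
    unfolding has_colored_copy_iff by blast
  have "t choose 2 \<le> card {A \<in> quads {..<Suc t}. contains_01 A = True}"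
    using berge_core_card[OF _ _ C(3)] C finite_subset by auto
  also have "\<dots> = (t - 1) choose 2"
    using card_quads_containing_pair[of "{..<Suc t}" "{0, 1}"] assms(1)
    by (simp add: contains_01_def)
  finally show False using assms(1) choose_two_Suc[of "t - 1"] by simp
qed

lemma no_copy_avoiding:
  assumes "2 \<le> t"
  shows "\<not> has_colored_copy 4 t contains_01 False (BK 4 t)"
proof
  assume "has_colored_copy 4 t contains_01 False (BK 4 t)"
  then obtain C where C: "C \<subseteq> {..<t}" "card C = t"
      "berge_core {A \<in> quads {..<t}. contains_01 A = False} C"
    unfolding has_colored_copy_iff by blast
  have "C = {..<t}" using C card_subset_eq[of "{..<t}" C] by simp
  then have "{0, 1} \<in> pairs C" using assms by auto
  then obtain A where "contains_01 A = False" "{0, 1} \<subseteq> A"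
    using C(3) unfolding berge_core_def by blast
  then show False unfolding contains_01_def by blast
qed

lemma no_copy_avoiding_small:
  assumes "2 \<le> t" "t \<le> 5"
  shows "\<not> has_colored_copy 4 (Suc t) contains_01 False (BK 4 t)"
proof
  let ?V = "{..<Suc t}"
  assume "has_colored_copy 4 (Suc t) contains_01 False (BK 4 t)"
  then obtain C where C: "C \<subseteq> ?V" "card C = t"
      "berge_core {A \<in> quads ?V. contains_01 A = False} C"
    unfolding has_colored_copy_iff by blast
  have "{A \<in> quads ?V. contains_01 A = False} = quads ?V - {A \<in> quads ?V. {0, 1} \<subseteq> A}"
    unfolding contains_01_def by auto
  moreover have "t choose 2 \<le> card {A \<in> quads ?V. contains_01 A = False}"
    using berge_core_card[OF _ _ C(3)] C finite_subset by auto
  ultimately have "t choose 2 \<le> card (quads ?V) - card {A \<in> quads ?V. {0, 1} \<subseteq> A}"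
    by (simp add: card_Diff_subset)
  also have "\<dots> = (Suc t choose 4) - ((t - 1) choose 2)"
    using card_quads_containing_pair[of ?V "{0, 1}"] assms(1) by (simp add: card_quads)
  finally have le: "t choose 2 \<le> (Suc t choose 4) - ((t - 1) choose 2)" .
  have "t \<in> {2, 3, 4, 5}" using assms by auto
  then show False using le by (auto simp: numeral_eq_Suc)
qed

theorem theorem1p6:
  "(\<forall>t::nat. 2 \<le> t \<and> t \<le> 5 \<longrightarrow> ramsey_number 4 (BK 4 t) (BK 4 t) = enat (t + 2)) \<and>
   (\<forall>t::nat. 6 \<le> t \<longrightarrow> ramsey_number 4 (BK 4 t) (BK 4 t) = enat (t + 1))"
proof (intro conjI allI impI)
  fix t :: nat assume t: "2 \<le> t \<and> t \<le> 5"
  let ?V = "{..<Suc (Suc t)}"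
  have "ramsey_number 4 (BK 4 t) (BK 4 t) = enat (Suc (Suc t))"
  proof (rule ramsey_number_eqI)
    show "\<not> has_colored_copy 4 (Suc t) contains_01 b (BK 4 t)" for b
      using t no_copy_containing[of t "Suc t"] no_copy_avoiding_small[of t] by (cases b) auto
    fix F assume F: "F \<subseteq> quads ?V"
    have G: "quads ?V - F \<subseteq> quads ?V" by blast
    have V: "finite ?V" "card ?V = Suc (Suc t)" by simp_all
    consider "t = 2" | "t = 3" | "t = 4" | "t = 5" using t by linarith
    then show "\<exists>C\<subseteq>?V. card C = t \<and> (berge_core F C \<or> berge_core (quads ?V - F) C)"
    proof cases
      case 1
      have C: "{0, 1} \<subseteq> ?V" "card {0, 1 :: nat} = 2" by auto
      have "?V \<in> F \<or> ?V \<in> quads ?V - F" using 1 unfolding quads_def by auto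
      then have "berge_core F {0, 1} \<or> berge_core (quads ?V - F) {0, 1}"
        using berge_core_pair[OF _ C] by blast
      then show ?thesis using C 1 by (intro exI[of _ "{0, 1}"]) simp
    next
      case 2
      have "3 \<le> card F \<or> 3 \<le> card (quads ?V - F)"
        using F 2 by (intro majority) (auto simp: card_quads numeral_eq_Suc)
      then show ?thesis using berge_core_5[OF V(1) _ F] berge_core_5[OF V(1) _ G] 2 by auto
    next
      case 3
      have "8 \<le> card F \<or> 8 \<le> card (quads ?V - F)"
        using F 3 by (intro majority) (auto simp: card_quads numeral_eq_Suc)
      then show ?thesis using berge_core_6[OF V(1) _ F] berge_core_6[OF V(1) _ G] 3 by auto
    next
      case 4
      obtain C where C: "C \<subseteq> ?V" "card C = 6" "berge_core F C \<or> berge_core (quads ?V - F) C"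
        using berge_core_monochromatic[of 6 ?V F] F 4 by auto
      obtain D where D: "D \<subseteq> C" "card D = 5"
        using obtain_subset_with_card_n[of 5 C] C(2) by auto
      have "D \<subseteq> ?V" using D C by blast
      then show ?thesis using C(3) D 4 berge_core_subset by blast
    qed
  qed
  then show "ramsey_number 4 (BK 4 t) (BK 4 t) = enat (t + 2)" by simp
next
  fix t :: nat assume t: "6 \<le> t"
  have "ramsey_number 4 (BK 4 t) (BK 4 t) = enat (Suc t)"
  proof (rule ramsey_number_eqI)
    show "\<not> has_colored_copy 4 t contains_01 b (BK 4 t)" for b
      using t no_copy_containing[of t t] no_copy_avoiding[of t] by (cases b) auto
    fix F assume "F \<subseteq> quads {..<Suc t}"
    then show "\<exists>C\<subseteq>{..<Suc t}. card C = t \<and> (berge_core F C \<or> berge_core (quads {..<Suc t} - F) C)"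
      by (intro berge_core_monochromatic[OF t]) auto
  qed
  then show "ramsey_number 4 (BK 4 t) (BK 4 t) = enat (t + 1)" by simp
qed

end
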